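(* Let $m\ge 2$. If $m=2k$, let $\beta_f(m)=\frac{k+1+\sqrt{k^2+6k+1}}{2}$ (the positive root of $x^2-(k+1)x-k=0$). Then: (1) $|W_{\beta,m}|=1$ for $\beta\in(\mathcal{G}(m),\beta_f(m)]$; (2) $|W_{\beta,m}|=\aleph_0$ for $\beta\in(\beta_f(m),\beta_c(m))$; (3) $|W_{\beta,m}|=2^{\aleph_0}$ for $\beta=\beta_c(m)$; (4) $W_{\beta,m}$ has positive Hausdorff dimension for $\beta\in(\beta_c(m),m+1]$. If $m=2k+1$, let $\beta_f(m)$ be the largest real root of $x^3-(k+2)x^2+x-(k+1)=0$. Then: (1) $|W_{\beta,m}|=2$ for $\beta\in(\mathcal{G}(m),\beta_f(m)]$; (2) $|W_{\beta,m}|=\aleph_0$ for $\beta\in(\beta_f(m),\beta_c(m))$; (3) $|W_{\beta,m}|=2^{\aleph_0}$ for $\beta=\beta_c(m)$; (4) $W_{\beta,m}$ has positive Hausdorff dimension for $\beta\in(\beta_c(m),m+1]$.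
   Context: For $\beta\in(1,m+1]$ and $x\in[0,\frac{m}{\beta-1}]$ let $\Sigma_{\beta,m}(x)=\{(\epsilon_i)\in\{0,\ldots,m\}^{\mathbb{N}}:\sum_{i\ge1}\epsilon_i\beta^{-i}=x\}$. Let $W_{\beta,m}=\{x\in(\frac{m+1-\beta}{\beta-1},1): |\Sigma_{\beta,m}(x)|=1\}$. Define $\mathcal{G}(m)=k+1$ if $m=2k$ and $\mathcal{G}(m)=\frac{k+1+\sqrt{k^2+6k+5}}{2}$ if $m=2k+1$. Let $(\lambda_i)_{i\ge0}$ be the Thue–Morse sequence: $\lambda_0=0$, $\lambda_{2i}=\lambda_i$, $\lambda_{2i+1}=1-\lambda_i$. For $i\ge1$ set $\lambda_i(m)=k+\lambda_i-\lambda_{i-1}$ if $m=2k$ and $\lambda_i(m)=k+\lambda_i$ if $m=2k+1$. Let $\beta_c(m)$ be the unique solution $\beta>1$ of $\sum_{i=1}^\infty \lambda_i(m)\beta^{-i}=1$. Hausdorff dimension is with respect to the usual metric on $\mathbb{R}$. *)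

theory Defs
  imports "HOL-Analysis.Analysis" "HOL-Library.Equipollence"
begin

text \<open>Sequences (eps_1, eps_2, ...) are represented by eps :: nat => nat with
  eps i standing for eps_(i+1); so the value is sum_i eps i / beta^(i+1).\<close>
definition Sigma_bm :: "real \<Rightarrow> nat \<Rightarrow> real \<Rightarrow> (nat \<Rightarrow> nat) set" where
  "Sigma_bm \<beta> m x = {\<epsilon>. (\<forall>i. \<epsilon> i \<le> m) \<and> (\<lambda>i. real (\<epsilon> i) / \<beta> ^ Suc i) sums x}"

definition W_bm :: "real \<Rightarrow> nat \<Rightarrow> real set" where
  "W_bm \<beta> m = {x. (real m + 1 - \<beta>) / (\<beta> - 1) < x \<and> x < 1 \<and> card (Sigma_bm \<beta> m x) = 1}"

definition G_m :: "nat \<Rightarrow> real" where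
  "G_m m = (let k = m div 2 in
     if even m then real k + 1
     else (real k + 1 + sqrt (real k ^ 2 + 6 * real k + 5)) / 2)"

fun thue_morse :: "nat \<Rightarrow> nat" where
  "thue_morse n = (if n = 0 then 0
     else if even n then thue_morse (n div 2) else 1 - thue_morse (n div 2))"

text \<open>lambda_i(m), meaningful for i >= 1.\<close>
definition lam_m :: "nat \<Rightarrow> nat \<Rightarrow> real" where
  "lam_m m i = (if even m
     then real (m div 2) + real (thue_morse i) - real (thue_morse (i - 1))
     else real (m div 2) + real (thue_morse i))"

definition beta_c :: "nat \<Rightarrow> real" where
  "beta_c m = (THE \<beta>. \<beta> > 1 \<and> (\<lambda>i. lam_m m (Suc i) / \<beta> ^ Suc i) sums 1)"

definition beta_f :: "nat \<Rightarrow> real" where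
  "beta_f m = (let k = real (m div 2) in
     if even m then (k + 1 + sqrt (k ^ 2 + 6 * k + 1)) / 2
     else Max {x::real. x ^ 3 - (k + 2) * x ^ 2 + x - (k + 1) = 0})"

definition hausdorff_content :: "real \<Rightarrow> real \<Rightarrow> real set \<Rightarrow> ennreal" where
  "hausdorff_content s \<delta> A =
     (INF U \<in> {U :: nat \<Rightarrow> real set. A \<subseteq> (\<Union>i. U i) \<and>
                 (\<forall>i. bounded (U i) \<and> diameter (U i) \<le> \<delta>)}.
        (\<Sum>i. ennreal (diameter (U i) powr s)))"

definition hausdorff_measure :: "real \<Rightarrow> real set \<Rightarrow> ennreal" where
  "hausdorff_measure s A = (SUP \<delta> \<in> {0<..}. hausdorff_content s \<delta> A)"

definition hausdorff_dim :: "real set \<Rightarrow> real" where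
  "hausdorff_dim A = Inf {s. 0 \<le> s \<and> hausdorff_measure s A = 0}"

end

theory Submission
  imports Defs "HOL-Computational_Algebra.Polynomial"
begin

text \<open>A point lies in \<open>W\<close> iff all tails of one of its expansions have values in the interval
  \<open>(m / (\<beta> - 1) - 1, 1)\<close>. Hence for \<open>\<beta> \<le> beta_c m\<close> every tail of such an expansion, and of its reflection, is
  lexicographically below the Thue--Morse type expansion of \<open>1\<close> in base \<open>beta_c m\<close>; conversely this
  lexicographic condition forces the tails below \<open>1\<close>.

  Up to \<open>beta_f m\<close>, comparing sizes of consecutive tails (centred at the symmetry point \<open>m / (2 (\<beta> - 1))\<close>)
  leaves only one or two expansions. Strictly below the Thue--Morse bound, its prefixes of length \<open>2 ^ n\<close> can occur
  only up to some level, and a sequence is eventually periodic once it has reached its highest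
  level. At \<open>beta_c m\<close> the \<open>2\<close>-adic shifts of the Thue--Morse sequence give a continuum of
  expansions. Above \<open>beta_c m\<close> there is room for the image of the full shift under an iterate of the Thue--Morse
  substitution, and distinct images are so well separated that the map back to binary
  expansions of \<open>[0, 1]\<close> is Hoelder continuous.\<close>

section \<open>Orbits and unique expansions\<close>

text \<open>Membership is a strict condition on infinitely many tails, so a strict inequality
  between \<open>\<beta>\<close> and \<open>beta_c m\<close> has to be made uniform. Truncation does
  this. Below \<open>beta_c m\<close>, a finite Thue--Morse prefix padded with the digit
  \<open>0\<close> still has value at least 1, which bounds the place of the first difference. Above
  \<open>beta_c m\<close>, a finite prefix padded with the digit \<open>m\<close> still has value
  below 1, which leaves a margin independent of the sequence. The threshold \<open>beta_f m\<close>
  is the base at which a further periodic orbit reaches the ends of the interval. For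
  \<open>m = 2 k\<close> its digits repeat \<open>k + 1, k - 1\<close>, at distance
  \<open>1 / (\<beta> + 1)\<close> from the symmetry point. For \<open>m = 2 k + 1\<close> they
  repeat \<open>k + 1, k + 1, k, k\<close>, at greatest distance
  \<open>(\<beta> + 1) / (2 (\<beta>\<^sup>2 + 1))\<close>. Equating these distances with the
  half-width of the interval gives the quadratic and the cubic.\<close>

definition orb :: "real \<Rightarrow> (nat \<Rightarrow> nat) \<Rightarrow> (nat \<Rightarrow> real) \<Rightarrow> bool" where
  "orb \<beta> \<epsilon> \<tau> \<longleftrightarrow> (\<forall>n. \<beta> * \<tau> n = real (\<epsilon> n) + \<tau> (Suc n))"

definition uorb :: "real \<Rightarrow> nat \<Rightarrow> (nat \<Rightarrow> nat) \<Rightarrow> (nat \<Rightarrow> real) \<Rightarrow> bool" where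
  "uorb \<beta> m \<epsilon> \<tau> \<longleftrightarrow> orb \<beta> \<epsilon> \<tau> \<and>
     (\<forall>n. \<epsilon> n \<le> m \<and> (real m + 1 - \<beta>) / (\<beta> - 1) < \<tau> n \<and> \<tau> n < 1)"

definition val :: "real \<Rightarrow> (nat \<Rightarrow> nat) \<Rightarrow> nat \<Rightarrow> real" where
  "val \<beta> \<epsilon> n = (\<Sum>i. real (\<epsilon> (n + i)) / \<beta> ^ Suc i)"

text \<open>Each common digit cancels, so one step multiplies the difference of the tails by
  \<open>\<beta>\<close>. The starting places \<open>n\<close> and \<open>n'\<close> are
  independent, so a late tail can be compared with a fixed sequence read from its start.\<close>

lemma orb_agree:
  assumes "\<beta> > 1" "orb \<beta> \<epsilon> \<tau>" "orb \<beta> \<epsilon>' \<tau>'" "\<forall>i<K. \<epsilon> (n + i) = \<epsilon>' (n' + i)"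
  shows "\<tau> n - \<tau>' n' = (\<tau> (n + K) - \<tau>' (n' + K)) / \<beta> ^ K"
  using assms(4)
proof (induction K)
  case (Suc K)
  have "\<beta> * \<tau> (n + K) = \<epsilon> (n + K) + \<tau> (Suc (n + K))" "\<beta> * \<tau>' (n' + K) = \<epsilon>' (n' + K) + \<tau>' (Suc (n' + K))"
    using assms(2,3) by (auto simp: orb_def)
  moreover have "\<epsilon> (n + K) = \<epsilon>' (n' + K)" using Suc.prems by auto
  ultimately have "\<beta> * (\<tau> (n + K) - \<tau>' (n' + K)) = \<tau> (n + Suc K) - \<tau>' (n' + Suc K)"
    by (simp add: algebra_simps)
  then have "\<tau> (n + K) - \<tau>' (n' + K) = (\<tau> (n + Suc K) - \<tau>' (n' + Suc K)) / \<beta>"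
    using assms(1) by (simp add: field_simps)
  then show ?case using Suc by simp
qed simp

lemma orb_differ:
  assumes "\<beta> > 1" "orb \<beta> \<epsilon> \<tau>" "orb \<beta> \<epsilon>' \<tau>'" "\<forall>i<K. \<epsilon> (n + i) = \<epsilon>' (n' + i)"
  shows "\<tau> n - \<tau>' n' = (real (\<epsilon> (n + K)) - real (\<epsilon>' (n' + K)) + \<tau> (Suc (n + K)) - \<tau>' (Suc (n' + K))) / \<beta> ^ Suc K"
proof -
  have "\<beta> * \<tau> (n + K) = \<epsilon> (n + K) + \<tau> (Suc (n + K))" "\<beta> * \<tau>' (n' + K) = \<epsilon>' (n' + K) + \<tau>' (Suc (n' + K))"
    using assms(2,3) by (auto simp: orb_def)
  then have "\<beta> * (\<tau> (n + K) - \<tau>' (n' + K)) = real (\<epsilon> (n + K)) - real (\<epsilon>' (n' + K)) + \<tau> (Suc (n + K)) - \<tau>' (Suc (n' + K))"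
    by (simp add: algebra_simps)
  then have "\<tau> (n + K) - \<tau>' (n' + K) = (real (\<epsilon> (n + K)) - real (\<epsilon>' (n' + K)) + \<tau> (Suc (n + K)) - \<tau>' (Suc (n' + K))) / \<beta>"
    using assms(1) by (simp add: field_simps)
  then show ?thesis using orb_agree[OF assms] by simp
qed

text \<open>The partial sums telescope. The recursion alone leaves \<open>\<tau> 0\<close> free;
  boundedness makes the remainder \<open>\<tau> (n + N) / \<beta> ^ N\<close> vanish.\<close>

lemma orb_sums:
  assumes b: "\<beta> > 1" and o: "orb \<beta> \<epsilon> \<tau>" and B: "\<forall>n. \<bar>\<tau> n\<bar> \<le> B"
  shows "(\<lambda>i. real (\<epsilon> (n + i)) / \<beta> ^ Suc i) sums \<tau> n"
proof -
  have *: "(\<Sum>i<N. real (\<epsilon> (n + i)) / \<beta> ^ Suc i) = \<tau> n - \<tau> (n + N) / \<beta> ^ N" for N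
  proof (induction N)
    case (Suc N)
    have "\<beta> * \<tau> (n + N) = real (\<epsilon> (n + N)) + \<tau> (n + Suc N)" using o by (auto simp: orb_def)
    then have "\<tau> (n + N) / \<beta> ^ N = real (\<epsilon> (n + N)) / \<beta> ^ Suc N + \<tau> (n + Suc N) / \<beta> ^ Suc N"
      using b by (simp add: field_simps)
    then show ?case using Suc by simp
  qed simp
  have "(\<lambda>N. \<tau> (n + N) / \<beta> ^ N) \<longlonglongrightarrow> 0"
  proof (rule Lim_null_comparison)
    show "\<forall>\<^sub>F N in sequentially. norm (\<tau> (n + N) / \<beta> ^ N) \<le> B * (1 / \<beta>) ^ N"
      using B b by (auto simp: power_divide abs_divide divide_right_mono)
    show "(\<lambda>N. B * (1 / \<beta>) ^ N) \<longlonglongrightarrow> 0"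
      using b by (intro tendsto_mult_right_zero LIMSEQ_power_zero) auto
  qed
  then have "(\<lambda>N. \<tau> n - \<tau> (n + N) / \<beta> ^ N) \<longlonglongrightarrow> \<tau> n - 0"
    by (intro tendsto_intros)
  then show ?thesis unfolding sums_def * by simp
qed

lemma geo_sums:
  assumes "(\<beta>::real) > 1"
  shows "(\<lambda>i. c / \<beta> ^ Suc i) sums (c / (\<beta> - 1))"
proof -
  have "(\<lambda>i. (c / \<beta>) * (1 / \<beta>) ^ i) sums ((c / \<beta>) * (1 / (1 - 1 / \<beta>)))"
    using assms by (intro sums_mult geometric_sums) auto
  moreover have "(c / \<beta>) * (1 / (1 - 1 / \<beta>)) = c / (\<beta> - 1)" using assms by (simp add: field_simps)
  moreover have "(c / \<beta>) * (1 / \<beta>) ^ i = c / \<beta> ^ Suc i" for i using assms by (simp add: field_simps)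
  ultimately show ?thesis by (simp only:)
qed

lemma digits_summable:
  assumes "\<beta> > 1" "\<forall>i. \<epsilon> i \<le> m"
  shows "summable (\<lambda>i. real (\<epsilon> (n + i)) / \<beta> ^ Suc i)"
proof (rule summable_comparison_test')
  show "summable (\<lambda>i. real m / \<beta> ^ Suc i)" using geo_sums[OF assms(1)] sums_summable by blast
  show "norm (real (\<epsilon> (n + i)) / \<beta> ^ Suc i) \<le> real m / \<beta> ^ Suc i" if "i \<ge> 0" for i
    using assms by (auto intro!: divide_right_mono simp del: power_Suc)
qed

lemma val_sums:
  assumes "\<beta> > 1" "\<forall>i. \<epsilon> i \<le> m"
  shows "(\<lambda>i. real (\<epsilon> (n + i)) / \<beta> ^ Suc i) sums val \<beta> \<epsilon> n"
  using digits_summable[OF assms] unfolding val_def by (rule summable_sums)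

lemma val_bounds:
  assumes "\<beta> > 1" "\<forall>i. \<epsilon> i \<le> m"
  shows "0 \<le> val \<beta> \<epsilon> n" "val \<beta> \<epsilon> n \<le> real m / (\<beta> - 1)"
proof -
  show "0 \<le> val \<beta> \<epsilon> n"
    using sums_le[OF _ sums_zero val_sums[OF assms]] assms by auto
  show "val \<beta> \<epsilon> n \<le> real m / (\<beta> - 1)"
    using assms by (intro sums_le[OF _ val_sums[OF assms] geo_sums]) (auto intro!: divide_right_mono simp del: power_Suc)
qed

lemma val_orb:
  assumes "\<beta> > 1" "\<forall>i. \<epsilon> i \<le> m"
  shows "orb \<beta> \<epsilon> (val \<beta> \<epsilon>)"
  unfolding orb_def
proof
  fix n
  have "(\<lambda>i. \<beta> * (real (\<epsilon> (n + i)) / \<beta> ^ Suc i)) sums (\<beta> * val \<beta> \<epsilon> n)"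
    using val_sums[OF assms] by (rule sums_mult)
  then have "(\<lambda>i. real (\<epsilon> (n + i)) / \<beta> ^ i) sums (\<beta> * val \<beta> \<epsilon> n)" using assms by simp
  then have "(\<lambda>i. real (\<epsilon> (n + Suc i)) / \<beta> ^ Suc i) sums (\<beta> * val \<beta> \<epsilon> n - real (\<epsilon> n))"
    by (subst sums_Suc_iff) simp
  moreover have "(\<lambda>i. real (\<epsilon> (n + Suc i)) / \<beta> ^ Suc i) sums val \<beta> \<epsilon> (Suc n)"
    using val_sums[OF assms, of "Suc n"] by simp
  ultimately show "\<beta> * val \<beta> \<epsilon> n = real (\<epsilon> n) + val \<beta> \<epsilon> (Suc n)"
    using sums_unique2 by fastforce
qed

lemma orb_val:
  assumes "\<beta> > 1" "orb \<beta> \<epsilon> \<tau>" "\<forall>n. \<bar>\<tau> n\<bar> \<le> B"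
  shows "\<tau> = val \<beta> \<epsilon>"
  using orb_sums[OF assms] by (auto simp: val_def sums_iff)

section \<open>Greedy expansions, and unique expansions as orbits\<close>

lemma ex_expansion:
  assumes b: "1 < \<beta>" "\<beta> \<le> real m + 1" and y: "0 \<le> y" "y \<le> real m / (\<beta> - 1)"
  shows "\<exists>\<epsilon>. (\<forall>i. \<epsilon> i \<le> m) \<and> (\<lambda>i. real (\<epsilon> i) / \<beta> ^ Suc i) sums y"
proof -
  \<comment> \<open>The greedy digit, capped at \<open>m\<close>. Below the cap the remainder is
    less than 1, hence at most \<open>m / (\<beta> - 1)\<close>; at the cap the range is kept
    because \<open>m / (\<beta> - 1)\<close> is the fixed point of subtracting \<open>m\<close>
    after scaling by \<open>\<beta>\<close>.\<close>
  define a where "a t = min m (nat \<lfloor>\<beta> * t\<rfloor>)" for t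
  define T where "T = rec_nat y (\<lambda>_ t. \<beta> * t - real (a t))"
  have T0: "T 0 = y" and TS: "T (Suc n) = \<beta> * T n - real (a (T n))" for n by (auto simp: T_def)
  have rng: "0 \<le> T n \<and> T n \<le> real m / (\<beta> - 1)" for n
  proof (induction n)
    case (Suc n)
    let ?t = "T n"
    have nn: "0 \<le> \<beta> * ?t" using Suc b by auto
    then have fl: "real (nat \<lfloor>\<beta> * ?t\<rfloor>) \<le> \<beta> * ?t" "\<beta> * ?t < real (nat \<lfloor>\<beta> * ?t\<rfloor>) + 1" by linarith+
    have ge1: "1 \<le> real m / (\<beta> - 1)" using b by (simp add: field_simps)
    show ?case
    proof (cases "nat \<lfloor>\<beta> * ?t\<rfloor> \<le> m")
      case True
      then have "T (Suc n) = \<beta> * ?t - real (nat \<lfloor>\<beta> * ?t\<rfloor>)" by (simp add: TS a_def)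
      then show ?thesis using fl ge1 by linarith
    next
      case False
      then have "a ?t = m" by (simp add: a_def)
      moreover have "real m \<le> \<beta> * ?t" using False fl by linarith
      moreover have "\<beta> * ?t \<le> \<beta> * (real m / (\<beta> - 1))" using Suc b by (intro mult_left_mono) auto
      moreover have "\<beta> * (real m / (\<beta> - 1)) - m = real m / (\<beta> - 1)" using b by (simp add: field_simps)
      ultimately show ?thesis by (simp add: TS)
    qed
  qed (use y T0 in auto)
  have "orb \<beta> (\<lambda>n. a (T n)) T" by (auto simp: orb_def TS)
  from orb_sums[OF b(1) this, of "real m / (\<beta> - 1)" 0] rng
  have "(\<lambda>i. real (a (T i)) / \<beta> ^ Suc i) sums y" by (simp add: T0)
  moreover have "\<forall>i. a (T i) \<le> m" by (simp add: a_def)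
  ultimately show ?thesis by (intro exI[of _ "\<lambda>i. a (T i)"]) simp
qed

lemma gap_left:
  assumes "1 < (\<beta>::real)"
  shows "(real m + 1 - \<beta>) / (\<beta> - 1) = real m / (\<beta> - 1) - 1"
  using assms by (simp add: field_simps)

lemma first_difference:
  fixes f g :: "nat \<Rightarrow> 'a"
  assumes "f \<noteq> g"
  obtains K where "\<forall>i<K. f i = g i" "f K \<noteq> g K"
proof -
  have "\<exists>K. f K \<noteq> g K" using assms by auto
  then show ?thesis using that exists_least_iff[of "\<lambda>K. f K \<noteq> g K"] by auto
qed

lemma uorb_val:
  assumes "1 < \<beta>" "\<beta> \<le> real m + 1" "uorb \<beta> m \<epsilon> \<tau>"
  shows "\<tau> = val \<beta> \<epsilon>"
proof (rule orb_val)
  show "orb \<beta> \<epsilon> \<tau>" using assms by (simp add: uorb_def)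
  have "0 \<le> (real m + 1 - \<beta>) / (\<beta> - 1)" using assms by auto
  then show "\<forall>n. \<bar>\<tau> n\<bar> \<le> 1" using assms(3) by (auto simp: uorb_def) (smt (verit))+
qed (use assms in auto)

text \<open>The interval in \<open>W_bm\<close> has lower end \<open>m / (\<beta> - 1) - 1\<close>, so changing a digit by at least one
  pushes the remaining tail out of the interval \<open>[0, m / (\<beta> - 1)]\<close> of representable numbers.\<close>

lemma uorb_unique:
  assumes b: "1 < \<beta>" "\<beta> \<le> real m + 1" and u: "uorb \<beta> m \<epsilon> \<tau>" and d: "\<forall>i. \<epsilon>' i \<le> m"
    and eq: "val \<beta> \<epsilon>' 0 = \<tau> 0"
  shows "\<epsilon>' = \<epsilon>"
proof (rule ccontr)
  assume "\<epsilon>' \<noteq> \<epsilon>"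
  then obtain K where K: "\<forall>i<K. \<epsilon>' i = \<epsilon> i" "\<epsilon>' K \<noteq> \<epsilon> K" by (rule first_difference)
  have "val \<beta> \<epsilon>' 0 - \<tau> 0 = (real (\<epsilon>' (0 + K)) - real (\<epsilon> (0 + K)) + val \<beta> \<epsilon>' (Suc (0 + K)) - \<tau> (Suc (0 + K))) / \<beta> ^ Suc K"
    using b d u K by (intro orb_differ val_orb[where m = m]) (auto simp: uorb_def)
  then have z: "real (\<epsilon>' K) - real (\<epsilon> K) + val \<beta> \<epsilon>' (Suc K) - \<tau> (Suc K) = 0"
    using eq b by simp
  have "0 \<le> val \<beta> \<epsilon>' (Suc K)" "val \<beta> \<epsilon>' (Suc K) \<le> real m / (\<beta> - 1)" using val_bounds[OF b(1) d] by auto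
  moreover have "real m / (\<beta> - 1) - 1 < \<tau> (Suc K)" "\<tau> (Suc K) < 1"
    using u gap_left[OF b(1), of m] by (auto simp: uorb_def)
  moreover have "real (\<epsilon>' K) \<ge> real (\<epsilon> K) + 1 \<or> real (\<epsilon>' K) + 1 \<le> real (\<epsilon> K)" using K(2) by linarith
  ultimately show False using z by linarith
qed

text \<open>\<open>W_bm\<close> restricts only the point, an orbit all its tails. A tail that left
  the interval would permit the preceding digit to be raised or lowered by one, giving a second
  expansion, unless that digit is already extremal. An extremal digit, however, cannot push the tail
  out on the side in question.\<close>

lemma W_iff:
  assumes b: "1 < \<beta>" "\<beta> \<le> real m + 1"
  shows "x \<in> W_bm \<beta> m \<longleftrightarrow> (\<exists>\<epsilon> \<tau>. uorb \<beta> m \<epsilon> \<tau> \<and> \<tau> 0 = x)"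
proof
  assume "\<exists>\<epsilon> \<tau>. uorb \<beta> m \<epsilon> \<tau> \<and> \<tau> 0 = x"
  then obtain \<epsilon> \<tau> where u: "uorb \<beta> m \<epsilon> \<tau>" "\<tau> 0 = x" by blast
  have d: "\<forall>i. \<epsilon> i \<le> m" using u by (auto simp: uorb_def)
  have "\<epsilon> \<in> Sigma_bm \<beta> m x"
    using val_sums[OF b(1) d, of 0] d u(2) uorb_val[OF b u(1)] by (auto simp: Sigma_bm_def)
  moreover have "\<epsilon>' = \<epsilon>" if "\<epsilon>' \<in> Sigma_bm \<beta> m x" for \<epsilon>'
  proof (rule uorb_unique[OF b u(1)])
    show "\<forall>i. \<epsilon>' i \<le> m" using that by (auto simp: Sigma_bm_def)
    show "val \<beta> \<epsilon>' 0 = \<tau> 0" using that u(2) by (auto simp: Sigma_bm_def val_def sums_iff)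
  qed
  ultimately have "Sigma_bm \<beta> m x = {\<epsilon>}" by blast
  then show "x \<in> W_bm \<beta> m" using u by (auto simp: W_bm_def uorb_def)
next
  assume x: "x \<in> W_bm \<beta> m"
  then obtain \<epsilon> where S: "Sigma_bm \<beta> m x = {\<epsilon>}" by (auto simp: W_bm_def card_1_singleton_iff)
  then have d: "\<forall>i. \<epsilon> i \<le> m" and v0: "val \<beta> \<epsilon> 0 = x" by (auto simp: Sigma_bm_def val_def sums_iff)
  let ?v = "val \<beta> \<epsilon>"
  have o: "orb \<beta> \<epsilon> ?v" using val_orb[OF b(1) d] .
  \<comment> \<open>Any digit with a representable remainder is the actual one: an expansion of the
    remainder, spliced in after place \<open>n\<close>, yields another expansion of
    \<open>x\<close>.\<close>
  have ch: "a = \<epsilon> n" if at: "a \<le> m" "real a + t = real (\<epsilon> n) + ?v (Suc n)" "0 \<le> t" "t \<le> real m / (\<beta> - 1)" for a t n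
  proof -
    obtain \<delta> where \<delta>: "\<forall>i. \<delta> i \<le> m" "(\<lambda>i. real (\<delta> i) / \<beta> ^ Suc i) sums t"
      using ex_expansion[OF b at(3,4)] by blast
    define \<epsilon>' where "\<epsilon>' i = (if i < n then \<epsilon> i else if i = n then a else \<delta> (i - Suc n))" for i
    have d': "\<forall>i. \<epsilon>' i \<le> m" using d \<delta> that(1) by (auto simp: \<epsilon>'_def)
    have "?v 0 - val \<beta> \<epsilon>' 0 = (real (\<epsilon> (0 + n)) - real (\<epsilon>' (0 + n)) + ?v (Suc (0 + n)) - val \<beta> \<epsilon>' (Suc (0 + n))) / \<beta> ^ Suc n"
      using o val_orb[OF b(1) d'] b by (intro orb_differ) (auto simp: \<epsilon>'_def)
    moreover have "val \<beta> \<epsilon>' (Suc n) = t" using \<delta>(2) by (auto simp: val_def sums_iff \<epsilon>'_def)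
    moreover have "\<epsilon>' n = a" by (simp add: \<epsilon>'_def)
    moreover have "real (\<epsilon> n) - real a + ?v (Suc n) - t = 0" using at(2) by linarith
    ultimately have "val \<beta> \<epsilon>' 0 = x" using v0 by simp
    then have "\<epsilon>' \<in> Sigma_bm \<beta> m x" using val_sums[OF b(1) d', of 0] d' by (auto simp: Sigma_bm_def)
    then have "\<epsilon>' = \<epsilon>" using S by auto
    then show "a = \<epsilon> n" using \<open>\<epsilon>' n = a\<close> by simp
  qed
  have "real m / (\<beta> - 1) - 1 < ?v n \<and> ?v n < 1" for n
  proof (induction n)
    case 0
    then show ?case using x gap_left[OF b(1), of m] by (auto simp: W_bm_def v0)
  next
    case (Suc n)
    let ?t = "?v (Suc n)"
    have bd: "0 \<le> ?t" "?t \<le> real m / (\<beta> - 1)" using val_bounds[OF b(1) d] by auto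
    have eq: "\<beta> * ?v n = real (\<epsilon> n) + ?t" using o by (auto simp: orb_def)
    have ge1: "1 \<le> real m / (\<beta> - 1)" using b by (simp add: field_simps)
    have "?t < 1"
    proof (rule ccontr)
      assume c: "\<not> ?t < 1"
      have "\<epsilon> n = m"
      proof (rule ccontr)
        assume "\<epsilon> n \<noteq> m"
        then have "Suc (\<epsilon> n) \<le> m" using d le_neq_implies_less by (metis Suc_leI)
        from ch[OF this, of "?t - 1" n] show False using c bd by auto
      qed
      then have "1 \<le> \<beta> * ?v n - m" using eq c by simp
      moreover have "(\<beta> - 1) * ?v n \<le> (\<beta> - 1) * (real m / (\<beta> - 1))" using Suc ge1 b by (intro mult_left_mono) linarith+
      then have "(\<beta> - 1) * ?v n \<le> m" using b by simp
      then have "\<beta> * ?v n - m \<le> ?v n" by (simp add: algebra_simps)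
      ultimately show False using Suc by linarith
    qed
    moreover have "real m / (\<beta> - 1) - 1 < ?t"
    proof (rule ccontr)
      assume c: "\<not> real m / (\<beta> - 1) - 1 < ?t"
      have "\<epsilon> n = 0"
      proof (rule ccontr)
        assume "\<epsilon> n \<noteq> 0"
        then have e: "\<epsilon> n - 1 \<le> m" "real (\<epsilon> n - 1) = real (\<epsilon> n) - 1" using d[rule_format, of n] by auto
        from ch[OF e(1), of "?t + 1" n] show False using c bd e(2) \<open>\<epsilon> n \<noteq> 0\<close> by auto
      qed
      then have "?t = \<beta> * ?v n" using eq by simp
      moreover have "1 * ?v n \<le> \<beta> * ?v n" using b val_bounds[OF b(1) d, of n] by (intro mult_right_mono) auto
      ultimately show False using c Suc by linarith
    qed
    ultimately show ?case by simp
  qed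
  then have "uorb \<beta> m \<epsilon> ?v" using o d gap_left[OF b(1), of m] by (auto simp: uorb_def)
  then show "\<exists>\<epsilon> \<tau>. uorb \<beta> m \<epsilon> \<tau> \<and> \<tau> 0 = x" using v0 by blast
qed

section \<open>Reflection and lexicographic comparison\<close>

lemma uorb_reflect:
  assumes b: "1 < \<beta>" and u: "uorb \<beta> m \<epsilon> \<tau>"
  shows "uorb \<beta> m (\<lambda>n. m - \<epsilon> n) (\<lambda>n. real m / (\<beta> - 1) - \<tau> n)"
proof -
  have "\<beta> * (real m / (\<beta> - 1) - \<tau> n) = real (m - \<epsilon> n) + (real m / (\<beta> - 1) - \<tau> (Suc n))" for n
  proof -
    have "\<beta> * (real m / (\<beta> - 1)) - m = real m / (\<beta> - 1)" using b by (simp add: field_simps)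
    moreover have "\<beta> * \<tau> n = real (\<epsilon> n) + \<tau> (Suc n)" "\<epsilon> n \<le> m" using u by (auto simp: uorb_def orb_def)
    ultimately show ?thesis by (simp add: algebra_simps of_nat_diff)
  qed
  moreover have "m - \<epsilon> n \<le> m" "real m / (\<beta> - 1) - 1 < real m / (\<beta> - 1) - \<tau> n" "real m / (\<beta> - 1) - \<tau> n < 1" for n
    using u gap_left[OF b, of m] by (auto simp: uorb_def) (smt (verit))
  ultimately show ?thesis using gap_left[OF b, of m] by (simp add: uorb_def orb_def)
qed

text \<open>A larger digit at the first difference would outweigh the tails, since those of
  \<open>\<epsilon>\<close> exceed \<open>m / (\<beta> - 1) - 1\<close> and those of
  \<open>\<alpha>\<close> are at most \<open>m / (\<beta> - 1)\<close>. Only the value of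
  \<open>\<alpha>\<close> enters, so truncated sequences qualify.\<close>

lemma uorb_lex_less:
  assumes b: "1 < \<beta>" and u: "uorb \<beta> m \<epsilon> \<tau>" and a: "\<forall>i. \<alpha> i \<le> m" "val \<beta> \<alpha> 0 \<ge> 1"
  shows "\<exists>K. (\<forall>i<K. \<epsilon> (n + i) = \<alpha> i) \<and> \<epsilon> (n + K) < \<alpha> K"
proof -
  have o: "orb \<beta> \<epsilon> \<tau>" "orb \<beta> \<alpha> (val \<beta> \<alpha>)" using u val_orb[OF b a(1)] by (auto simp: uorb_def)
  have r: "real m / (\<beta> - 1) - 1 < \<tau> k" "\<tau> k < 1" for k using u gap_left[OF b, of m] by (auto simp: uorb_def)
  have L: "(\<lambda>i. \<epsilon> (n + i)) \<noteq> \<alpha>"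
  proof
    assume e: "(\<lambda>i. \<epsilon> (n + i)) = \<alpha>"
    have d: "\<forall>i. \<epsilon> i \<le> m" using u by (auto simp: uorb_def)
    have "\<bar>\<tau> k\<bar> \<le> 1 + \<bar>real m / (\<beta> - 1)\<bar>" for k using r[of k] by linarith
    then have "\<tau> = val \<beta> \<epsilon>" using orb_val[OF b o(1)] by blast
    moreover have "val \<beta> \<epsilon> n = val \<beta> \<alpha> 0" using e by (auto simp: val_def)
    ultimately show False using a r[of n] by auto
  qed
  then obtain K where K: "\<forall>i<K. \<epsilon> (n + i) = \<alpha> i" "\<epsilon> (n + K) \<noteq> \<alpha> K" by (rule first_difference)
  have "\<not> \<epsilon> (n + K) > \<alpha> K"
  proof
    assume c: "\<epsilon> (n + K) > \<alpha> K"
    have "\<tau> n - val \<beta> \<alpha> 0 = (real (\<epsilon> (n + K)) - real (\<alpha> (0 + K)) + \<tau> (Suc (n + K)) - val \<beta> \<alpha> (Suc (0 + K))) / \<beta> ^ Suc K"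
      using b o K by (intro orb_differ) auto
    moreover have "real (\<epsilon> (n + K)) - real (\<alpha> (0 + K)) + \<tau> (Suc (n + K)) - val \<beta> \<alpha> (Suc (0 + K)) \<ge> 0"
      using val_bounds(2)[OF b a(1), of "Suc (0 + K)"] r(1)[of "Suc (n + K)"] c by auto
    ultimately have "\<tau> n - val \<beta> \<alpha> 0 \<ge> 0" using b by simp
    then show False using a r[of n] by auto
  qed
  then show ?thesis using K by (intro exI[of _ K]) auto
qed

text \<open>A tail that exceeds \<open>1\<close> by \<open>C\<close> would force a later tail to exceed \<open>1\<close> by \<open>\<beta> C\<close>, so by
  boundedness no tail exceeds \<open>1\<close>.\<close>

lemma lex_le_val:
  assumes b: "1 < \<beta>" and d: "\<forall>i. \<epsilon> i \<le> m" and a: "\<forall>i. \<alpha> i \<le> m" "val \<beta> \<alpha> 0 \<le> 1"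
    and lex: "\<forall>n K. (\<forall>i<K. \<epsilon> (n + i) = \<alpha> i) \<longrightarrow> \<epsilon> (n + K) \<le> \<alpha> K"
  shows "val \<beta> \<epsilon> n \<le> val \<beta> \<alpha> 0"
    and "(\<lambda>i. \<epsilon> (n + i)) \<noteq> \<alpha> \<Longrightarrow> \<forall>K. 0 < val \<beta> \<alpha> K \<Longrightarrow> val \<beta> \<epsilon> n < val \<beta> \<alpha> 0"
proof -
  let ?t = "val \<beta> \<epsilon>" and ?A = "val \<beta> \<alpha>"
  have o: "orb \<beta> \<epsilon> ?t" "orb \<beta> \<alpha> ?A" using val_orb[OF b] a d by auto
  have A0: "0 \<le> ?A k" for k using val_bounds(1)[OF b a(1)] by auto
  have dif: "\<exists>K. ?t n - ?A 0 \<le> (?t (Suc (n + K)) - 1 - ?A (Suc K)) / \<beta> ^ Suc K"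
    if ne: "(\<lambda>i. \<epsilon> (n + i)) \<noteq> \<alpha>" for n
  proof -
    obtain K where K: "\<forall>i<K. \<epsilon> (n + i) = \<alpha> i" "\<epsilon> (n + K) \<noteq> \<alpha> K" using ne by (rule first_difference)
    then have lt: "\<epsilon> (n + K) < \<alpha> K" using lex by (simp add: le_neq_implies_less)
    have "?t n - ?A 0 = (real (\<epsilon> (n + K)) - real (\<alpha> (0 + K)) + ?t (Suc (n + K)) - ?A (Suc (0 + K))) / \<beta> ^ Suc K"
      using b o K by (intro orb_differ) auto
    also have "\<dots> \<le> (?t (Suc (n + K)) - 1 - ?A (Suc K)) / \<beta> ^ Suc K"
      using lt b by (intro divide_right_mono) auto
    finally show ?thesis by blast
  qed
  have eqv: "?t n = ?A 0" if "(\<lambda>i. \<epsilon> (n + i)) = \<alpha>" for n using that by (auto simp: val_def)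
  define C where "C = real m / (\<beta> - 1)"
  have C: "C \<ge> 0" using b by (auto simp: C_def)
  have st: "?t n \<le> 1 + C / \<beta> ^ j" for n j
  proof (induction j arbitrary: n)
    case 0
    then show ?case using val_bounds(2)[OF b d, of n] by (auto simp: C_def)
  next
    case (Suc j)
    show ?case
    proof (cases "(\<lambda>i. \<epsilon> (n + i)) = \<alpha>")
      case True
      have "C / \<beta> ^ Suc j \<ge> 0" using C b by auto
      then show ?thesis using eqv[OF True] a by linarith
    next
      case False
      then obtain K where "?t n - ?A 0 \<le> (?t (Suc (n + K)) - 1 - ?A (Suc K)) / \<beta> ^ Suc K" using dif by blast
      also have "\<dots> \<le> (C / \<beta> ^ j) / \<beta> ^ Suc K"
        using Suc[of "Suc (n + K)"] A0[of "Suc K"] b by (intro divide_right_mono) auto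
      also have "\<dots> \<le> (C / \<beta> ^ j) / \<beta> ^ 1"
        using b C by (intro divide_left_mono power_increasing) auto
      finally have "?t n - ?A 0 \<le> C / \<beta> ^ Suc j" using b by (simp add: mult.commute)
      then show ?thesis using a by linarith
    qed
  qed
  have t1: "?t n \<le> 1" for n
  proof -
    have "(\<lambda>j. 1 + C * (1 / \<beta>) ^ j) \<longlonglongrightarrow> 1 + 0"
      using b by (intro tendsto_intros tendsto_mult_right_zero LIMSEQ_power_zero) auto
    then show ?thesis using st[of n]
      by (intro LIMSEQ_le_const[where X = "\<lambda>j. 1 + C * (1 / \<beta>) ^ j"]) (auto simp: power_divide)
  qed
  have *: "\<exists>K. ?t n - ?A 0 \<le> (- ?A (Suc K)) / \<beta> ^ Suc K" if ne: "(\<lambda>i. \<epsilon> (n + i)) \<noteq> \<alpha>"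
  proof -
    obtain K where "?t n - ?A 0 \<le> (?t (Suc (n + K)) - 1 - ?A (Suc K)) / \<beta> ^ Suc K" using dif[OF ne] by blast
    also have "\<dots> \<le> (- ?A (Suc K)) / \<beta> ^ Suc K" using t1[of "Suc (n + K)"] b by (intro divide_right_mono) auto
    finally show ?thesis by blast
  qed
  show "?t n \<le> ?A 0"
  proof (cases "(\<lambda>i. \<epsilon> (n + i)) = \<alpha>")
    case False
    then obtain K where K: "?t n - ?A 0 \<le> (- ?A (Suc K)) / \<beta> ^ Suc K" using * by blast
    have "(- ?A (Suc K)) / \<beta> ^ Suc K \<le> 0" using A0 b by (intro divide_nonpos_pos) auto
    then show ?thesis using K by linarith
  qed (use eqv in auto)
  show "?t n < ?A 0" if ne: "(\<lambda>i. \<epsilon> (n + i)) \<noteq> \<alpha>" and pos: "\<forall>K. 0 < ?A K"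
  proof -
    obtain K where K: "?t n - ?A 0 \<le> (- ?A (Suc K)) / \<beta> ^ Suc K" using *[OF ne] by blast
    have "(- ?A (Suc K)) / \<beta> ^ Suc K < 0" using pos b by (intro divide_neg_pos) auto
    then show ?thesis using K by linarith
  qed
qed

text \<open>The values of a tail and of its reflection add up to \<open>m / (\<beta> - 1)\<close>,
  so the lower end of the interval is the upper end for the reflected digits.\<close>

lemma uorb_val_pair:
  assumes b: "1 < \<beta>" and d: "\<forall>i. \<epsilon> i \<le> m"
    and "\<forall>n. val \<beta> \<epsilon> n < 1" "\<forall>n. val \<beta> (\<lambda>i. m - \<epsilon> i) n < 1"
  shows "uorb \<beta> m \<epsilon> (val \<beta> \<epsilon>)"
proof -
  have "val \<beta> (\<lambda>i. m - \<epsilon> i) n = real m / (\<beta> - 1) - val \<beta> \<epsilon> n" for n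
  proof -
    have "(\<lambda>i. real m / \<beta> ^ Suc i - real (\<epsilon> (n + i)) / \<beta> ^ Suc i) sums (real m / (\<beta> - 1) - val \<beta> \<epsilon> n)"
      by (intro sums_diff geo_sums b val_sums[OF b d])
    moreover have "(\<lambda>i. real m / \<beta> ^ Suc i - real (\<epsilon> (n + i)) / \<beta> ^ Suc i) = (\<lambda>i. real (m - \<epsilon> (n + i)) / \<beta> ^ Suc i)"
      using d by (auto simp: of_nat_diff diff_divide_distrib)
    ultimately show ?thesis by (simp add: val_def sums_iff)
  qed
  then show ?thesis using assms gap_left[OF b, of m] val_orb[OF b d]
    by (auto simp: uorb_def) (smt (verit))
qed

section \<open>The Thue--Morse sequence\<close>

text \<open>With boolean letters \<open>\<noteq>\<close> is addition modulo 2: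
  \<open>x \<noteq> s\<close> complements \<open>x\<close> exactly when \<open>s\<close> holds, so
  one statement covers a sequence and its complement.\<close>

definition tm :: "nat \<Rightarrow> bool" where
  "tm n \<longleftrightarrow> thue_morse n = 1"

declare thue_morse.simps [simp del]

lemma thue_morse_le_1: "thue_morse n \<le> 1"
proof (induction n rule: less_induct)
  case (less n)
  then show ?case using thue_morse.simps[of n] by (cases "n = 0") auto
qed

lemma of_bool_tm: "of_bool (tm n) = thue_morse n"
  using thue_morse_le_1[of n] by (auto simp: tm_def)

lemma tm_0 [simp]: "\<not> tm 0"
  by (simp add: tm_def thue_morse.simps)

lemma tm_even [simp]: "tm (2 * n) = tm n"
  by (cases "n = 0") (simp_all add: tm_def thue_morse.simps[of "2 * n"])

lemma tm_odd [simp]: "tm (Suc (2 * n)) = (\<not> tm n)"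
  using thue_morse_le_1[of n] by (auto simp add: tm_def thue_morse.simps[of "Suc (2 * n)"])

lemma tm_1 [simp]: "tm (Suc 0)"
  using tm_odd[of 0] by simp

lemma tm_2 [simp]: "tm 2" "tm (Suc (Suc 0))"
  using tm_even[of 1] by (auto simp: numeral_2_eq_2)

lemma tm_3 [simp]: "\<not> tm 3"
  using tm_odd[of 1] by (simp add: numeral_3_eq_3)

text \<open>\<open>tm n\<close> is the parity of the binary digit sum of \<open>n\<close>, and here
  the digits of \<open>q\<close> and \<open>r\<close> occupy disjoint places.\<close>

lemma tm_power_add: "r < 2 ^ n \<Longrightarrow> tm (q * 2 ^ n + r) = (tm q \<noteq> tm r)"
proof (induction n arbitrary: r)
  case (Suc n)
  then have "r div 2 < 2 ^ n" by auto
  from Suc.IH[OF this] have IH: "tm (q * 2 ^ n + r div 2) = (tm q \<noteq> tm (r div 2))" .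
  show ?case
  proof (cases "even r")
    case True
    then obtain k where k: "r = 2 * k" by blast
    then have "q * 2 ^ Suc n + r = 2 * (q * 2 ^ n + r div 2)" by simp
    then show ?thesis using IH k by (simp only: tm_even) simp
  next
    case False
    then obtain k where k: "r = Suc (2 * k)" using oddE by fastforce
    then have "q * 2 ^ Suc n + r = Suc (2 * (q * 2 ^ n + r div 2))" by simp
    then show ?thesis using IH k by (simp only: tm_odd) simp
  qed
qed simp

lemma tm_power [simp]: "tm (2 ^ n)"
  using tm_power_add[of 0 n 1] by simp

lemma tm_power_plus: "i < 2 ^ n \<Longrightarrow> tm (2 ^ n + i) = (\<not> tm i)"
  using tm_power_add[of i n 1] by simp

lemma even_odd_cases:
  fixes i :: nat
  obtains q where "i = 2 * q" | q where "i = Suc (2 * q)"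
  by (cases "even i") (auto elim!: evenE oddE)

text \<open>A tail starting after an odd position is smaller within two letters; one starting after an even
  position reduces to the tail at half that position.\<close>

lemma tm_tail_less:
  assumes "n > 0 \<or> s"
  shows "\<exists>K<max 1 (2 * n). (\<forall>i<K. (tm (n + Suc i) \<noteq> s) = tm (Suc i)) \<and> tm (n + Suc K) = s \<and> tm (Suc K)"
  using assms
proof (induction n rule: less_induct)
  case (less n)
  show ?case
  proof (cases n rule: even_odd_cases)
    case (2 j)
    have a: "tm (n + 1) = tm (j + 1)" "tm (n + 2) = (\<not> tm (j + 1))"
      using tm_even[of "j + 1"] tm_odd[of "j + 1"] 2 by (simp_all del: tm_even tm_odd)
    show ?thesis
    proof (cases "tm (j + 1) = s")
      case True
      then show ?thesis using a by (intro exI[of _ 0]) auto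
    next
      case False
      then show ?thesis using a 2 by (intro exI[of _ 1]) auto
    qed
  next
    case (1 j)
    have a: "tm (n + 1) = (\<not> tm j)" using tm_odd[of j] 1 by (simp del: tm_odd)
    show ?thesis
    proof (cases "tm j = s")
      case False
      then show ?thesis using a by (intro exI[of _ 0]) auto
    next
      case True
      then have j: "j > 0" using less.prems 1 by (cases "j = 0") auto
      then have "j < n" using 1 by auto
      from less.IH[OF this] j obtain K where K: "K < max 1 (2 * j)"
        "\<forall>i<K. (tm (j + Suc i) \<noteq> s) = tm (Suc i)" "tm (j + Suc K) = s" "tm (Suc K)" by blast
      have A: "(tm (j + q) \<noteq> s) = tm q" if "q \<le> K" for q
        using K(2) True that by (cases q) auto
      have B: "(tm (n + q) \<noteq> s) = tm q" if "q < 2 * Suc K" for q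
      proof (cases q rule: even_odd_cases)
        case (1 r)
        then have "n + q = 2 * (j + r)" using \<open>n = 2 * j\<close> by simp
        then show ?thesis using A[of r] that 1 by (simp only: tm_even) simp
      next
        case (2 r)
        then have "n + q = Suc (2 * (j + r))" using \<open>n = 2 * j\<close> by simp
        then show ?thesis using A[of r] that 2 by (simp only: tm_odd) auto
      qed
      have t: "tm (2 * (j + Suc K)) = s" "tm (2 * Suc K)" using K(3,4) by (simp_all only: tm_even)
      have e: "n + Suc (2 * K + 1) = 2 * (j + Suc K)" "Suc (2 * K + 1) = 2 * Suc K" using 1 by simp_all
      show ?thesis
      proof (intro exI[of _ "2 * K + 1"] conjI)
        show "2 * K + 1 < max 1 (2 * n)" using K(1) 1 j by auto
        show "tm (n + Suc (2 * K + 1)) = s" "tm (Suc (2 * K + 1))"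
          unfolding e(1) by (rule t(1)) (unfold e(2), rule t(2))
        show "\<forall>i<2 * K + 1. (tm (n + Suc i) \<noteq> s) = tm (Suc i)"
        proof (intro allI impI)
          fix i assume "i < 2 * K + 1"
          then show "(tm (n + Suc i) \<noteq> s) = tm (Suc i)" by (intro B) simp
        qed
      qed
    qed
  qed
qed

text \<open>The \<open>n\<close>-fold Thue--Morse substitution, sending \<open>0\<close> to \<open>01\<close> and \<open>1\<close> to \<open>10\<close>, applied to \<open>c\<close>.\<close>

definition dbl :: "nat \<Rightarrow> (nat \<Rightarrow> bool) \<Rightarrow> nat \<Rightarrow> bool" where
  "dbl n c i \<longleftrightarrow> c (i div 2 ^ n) \<noteq> tm (i mod 2 ^ n)"

lemma dbl_Suc:
  "dbl (Suc n) c (2 * i) = dbl n c i" "dbl (Suc n) c (Suc (2 * i)) = (\<not> dbl n c i)"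
proof -
  have "(2 * i) div 2 ^ Suc n = i div 2 ^ n" "Suc (2 * i) div 2 ^ Suc n = i div 2 ^ n"
    by (simp_all add: div_mult2_eq)
  moreover have "(2 * i) mod 2 ^ Suc n = 2 * (i mod 2 ^ n)" "Suc (2 * i) mod 2 ^ Suc n = Suc (2 * (i mod 2 ^ n))"
    by (simp_all add: mod_mult2_eq)
  ultimately show "dbl (Suc n) c (2 * i) = dbl n c i" "dbl (Suc n) c (Suc (2 * i)) = (\<not> dbl n c i)"
    unfolding dbl_def by auto
qed

text \<open>The halving argument for the Thue--Morse sequence works for every substituted sequence,
  but each halving uses up one level. As \<open>c\<close> is arbitrary, the comparison is controlled
  only for the first \<open>2 ^ n - 1\<close> letters.\<close>

lemma dbl_prefix_le:
  assumes "Suc K < 2 ^ n" "\<forall>i<K. (dbl n c (p + Suc i) \<noteq> s) = tm (Suc i)" "dbl n c (p + Suc K) \<noteq> s"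
  shows "tm (Suc K)"
  using assms
proof (induction n arbitrary: p K)
  case (Suc n)
  let ?d = "dbl (Suc n) c" and ?e = "dbl n c"
  show ?case
  proof (cases "K = 0")
    case True
    then show ?thesis by simp
  next
    case K0: False
    then have f0: "?d (p + 1) \<noteq> s" using Suc.prems(2) by (auto dest!: spec[of _ 0])
    show ?thesis
    proof (cases p rule: even_odd_cases)
      case (2 j)
      have "?d (p + 1) = ?e (j + 1)" "?d (p + 2) = (\<not> ?e (j + 1))"
        using dbl_Suc[of n c "j + 1"] 2 by simp_all
      then have n2: "\<not> (?d (p + 2) \<noteq> s)" using f0 by auto
      show ?thesis
      proof (cases "K = 1")
        case False
        then have "1 < K" using K0 by auto
        then show ?thesis using Suc.prems(2) n2 by (auto dest!: spec[of _ 1])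
      qed simp
    next
      case (1 j)
      have "?d (p + 1) = (\<not> ?e j)" using dbl_Suc(2)[of n c j] 1 by simp
      then have ej: "?e j = s" using f0 by auto
      have e: "?d (p + 2 * q) = ?e (j + q)" "?d (p + Suc (2 * q)) = (\<not> ?e (j + q))" for q
        using dbl_Suc[of n c "j + q"] 1 by (simp_all add: algebra_simps)
      show ?thesis
      proof (cases "Suc K" rule: even_odd_cases)
        case (2 q)
        then obtain r where r: "q = Suc r" using K0 by (cases q) auto
        then have "2 * r + 1 < K" "Suc (2 * r + 1) = 2 * q" using 2 by auto
        then have "(?d (p + 2 * q) \<noteq> s) = tm (2 * q)" using Suc.prems(2) by metis
        then show ?thesis using e[of q] Suc.prems(3) 2 by auto
      next
        case (1 q)
        then obtain r where r: "q = Suc r" by (cases q) auto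
        have "tm (Suc r)"
        proof (rule Suc.IH)
          show "Suc r < 2 ^ n" using Suc.prems(1) 1 r by auto
          show "?e (j + Suc r) \<noteq> s" using Suc.prems(3) 1 r e(1)[of q] by auto
          show "\<forall>i<r. (?e (j + Suc i) \<noteq> s) = tm (Suc i)"
          proof (intro allI impI)
            fix i assume "i < r"
            then have "2 * i + 1 < K" "Suc (2 * i + 1) = 2 * Suc i" using 1 r by auto
            then have "(?d (p + 2 * Suc i) \<noteq> s) = tm (2 * Suc i)" using Suc.prems(2) by metis
            then show "(?e (j + Suc i) \<noteq> s) = tm (Suc i)" using e(1)[of "Suc i"] by (simp only: tm_even)
          qed
        qed
        then show ?thesis using 1 r tm_even[of "Suc r"] by (simp del: tm_even)
      qed
    qed
  qed
qed simp

text \<open>Equal neighbours start at an odd place, so a repetition reveals the parity of the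
  position; the rest is halving. Only the pattern of equalities is used, because for even
  \<open>m\<close> the digits show increments and not letters.\<close>

lemma tm_recognizable:
  assumes "\<forall>i<2 * 2 ^ a. (tm (n + i) = tm (n + Suc i)) = (tm (n' + i) = tm (n' + Suc i))"
  shows "n mod 2 ^ a = n' mod 2 ^ a"
  using assms
proof (induction a arbitrary: n n')
  case (Suc a)
  have odd_pos: "odd p" if "tm p = tm (Suc p)" for p
    using that by (cases p rule: even_odd_cases) auto
  have eq_odd: "(tm (Suc (2 * h)) = tm (Suc (Suc (2 * h)))) = (tm h \<noteq> tm (Suc h))" for h
    using tm_even[of "Suc h"] by auto
  have alt: "tm (2 * h) \<noteq> tm (Suc (2 * h))" for h by simp
  \<comment> \<open>Three consecutive letters are never all equal, and a change between
    \<open>h\<close> and \<open>Suc h\<close> becomes a repetition at \<open>Suc (2 * h)\<close>.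
    Hence four places suffice.\<close>
  have ex: "\<exists>i<4. tm (n + i) = tm (n + Suc i)"
  proof -
    obtain h d where hd: "n + d = Suc (2 * h)" "d < 2"
    proof (cases n rule: even_odd_cases)
      case (1 q) then show ?thesis using that[of 1 q] by simp
    next
      case (2 q) then show ?thesis using that[of 0 q] by simp
    qed
    have "tm h \<noteq> tm (Suc h) \<or> tm (Suc h) \<noteq> tm (Suc (Suc h))"
      by (cases h rule: even_odd_cases) (use alt[of "Suc _"] in auto)
    then have "tm (Suc (2 * h)) = tm (Suc (Suc (2 * h))) \<or> tm (Suc (2 * Suc h)) = tm (Suc (Suc (2 * Suc h)))"
      using eq_odd by blast
    then have "tm (n + d) = tm (n + Suc d) \<or> tm (n + (d + 2)) = tm (n + Suc (d + 2))"
      using hd(1) by (simp add: add.assoc[symmetric])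
    moreover have "d < 4" "d + 2 < 4" using hd(2) by auto
    ultimately show ?thesis by blast
  qed
  then obtain i where i: "i < 4" "tm (n + i) = tm (n + Suc i)" by blast
  have "(4::nat) \<le> 2 * 2 ^ Suc a" by simp
  then have "i < 2 * 2 ^ Suc a" using i(1) by linarith
  then have "tm (n' + i) = tm (n' + Suc i)" using Suc.prems i(2) by blast
  then have "odd (n + i)" "odd (n' + i)" using odd_pos[of "n + i"] odd_pos[of "n' + i"] i(2) by simp_all
  then have par: "even n = even n'" by presburger
  obtain h h' e where h: "n = 2 * h + e" "n' = 2 * h' + e" "e \<le> 1"
  proof (cases n rule: even_odd_cases)
    case (1 q) then show ?thesis using that[of q 0 "n' div 2"] par by auto
  next
    case (2 q) then show ?thesis using that[of q 1 "n' div 2"] par by auto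
  qed
  have "h mod 2 ^ a = h' mod 2 ^ a"
  proof (rule Suc.IH, intro allI impI)
    fix i :: nat assume i: "i < 2 * 2 ^ a"
    define t where "t = 2 * i + 1 - e"
    have t: "t < 2 * 2 ^ Suc a" "n + t = Suc (2 * (h + i))" "n' + t = Suc (2 * (h' + i))"
      using i h by (auto simp: t_def)
    have "(tm (n + t) = tm (Suc (n + t))) = (tm (n' + t) = tm (Suc (n' + t)))"
      using Suc.prems t(1) by simp
    then have "(tm (Suc (2 * (h + i))) = tm (Suc (Suc (2 * (h + i))))) = (tm (Suc (2 * (h' + i))) = tm (Suc (Suc (2 * (h' + i)))))"
      unfolding t(2,3) .
    then show "(tm (h + i) = tm (h + Suc i)) = (tm (h' + i) = tm (h' + Suc i))"
      unfolding eq_odd by auto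
  qed
  moreover have "(2 * h + e) mod 2 ^ Suc a = 2 * (h mod 2 ^ a) + e" for h
  proof -
    have "(2 * h + e) div 2 = h" "(2 * h + e) mod 2 = e" using h(3) by (auto simp: le_Suc_eq)
    then show ?thesis unfolding power_Suc mod_mult2_eq by simp
  qed
  ultimately show ?case using h by simp
qed simp

text \<open>If the Thue--Morse prefix of length \<open>2 ^ n\<close> (or its complement) occurs in a constrained sequence, then it
  is followed by its complement or it extends to the prefix of double length. When the bound is
  strict the doubling must stop, and the sequence is eventually periodic.\<close>

lemma block_step:
  assumes C: "\<forall>n s. b n = s \<longrightarrow> (\<exists>K. (\<forall>i<K. (b (n + Suc i) \<noteq> s) = tm (Suc i)) \<and> b (n + Suc K) = s \<and> tm (Suc K))"
    and st: "\<forall>i\<le>2 ^ n. (b (p + i) \<noteq> s) = tm i"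
  shows "(\<forall>i\<le>2 ^ n. (b (p + 2 ^ n + i) \<noteq> (\<not> s)) = tm i) \<or> (\<forall>i\<le>2 ^ Suc n. (b (p + i) \<noteq> s) = tm i)"
proof -
  let ?q = "p + 2 ^ n"
  have "b p = s" using st[rule_format, of 0] by auto
  then obtain K1 where K1: "\<forall>i<K1. (b (p + Suc i) \<noteq> s) = tm (Suc i)" "b (p + Suc K1) = s" "tm (Suc K1)"
    using C[rule_format, of p s] by blast
  have "b ?q = (\<not> s)" using st[rule_format, of "2 ^ n"] by auto
  then obtain K2 where K2: "\<forall>i<K2. (b (?q + Suc i) \<noteq> (\<not> s)) = tm (Suc i)" "b (?q + Suc K2) = (\<not> s)" "tm (Suc K2)"
    using C[rule_format, of ?q "\<not> s"] by blast
  have A1: "(b (p + i) \<noteq> s) = tm i" if "i \<le> K1" for i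
    using K1(1) that \<open>b p = s\<close> by (cases i) auto
  have A2: "(b (?q + i) \<noteq> (\<not> s)) = tm i" if "i \<le> K2" for i
    using K2(1) that \<open>b ?q = (\<not> s)\<close> by (cases i) auto
  have le: "2 ^ n \<le> Suc K2"
  proof (rule ccontr)
    assume "\<not> 2 ^ n \<le> Suc K2"
    then have lt: "Suc K2 < 2 ^ n" by simp
    have "\<not> (Suc K1 \<le> 2 ^ n + Suc K2)"
    proof
      assume a: "Suc K1 \<le> 2 ^ n + Suc K2"
      show False
      proof (cases "Suc K1 \<le> 2 ^ n")
        case True
        then show False using st K1(2,3) by auto
      next
        case False
        define r where "r = Suc K1 - 2 ^ n"
        then have r: "Suc K1 = 2 ^ n + r" "r \<le> Suc K2" using a False by linarith+
        then have tr: "\<not> tm r" using K1(3) tm_power_plus[of r n] lt by auto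
        then have "r \<noteq> Suc K2" using K2(3) by auto
        then have "(b (?q + r) \<noteq> (\<not> s)) = tm r" using A2[of r] r by auto
        then show False using tr K1(2) r(1) by (metis add.assoc)
      qed
    qed
    then have "(b (p + (2 ^ n + Suc K2)) \<noteq> s) = tm (2 ^ n + Suc K2)" by (intro A1) auto
    then show False using K2(2,3) tm_power_plus[OF lt] by (simp add: add.assoc)
  qed
  have A: "(b (?q + i) \<noteq> (\<not> s)) = tm i" if "i < 2 ^ n" for i using A2 le that by auto
  show ?thesis
  proof (cases "b (?q + 2 ^ n) = s")
    case True
    then have "(b (?q + i) \<noteq> (\<not> s)) = tm i" if "i \<le> 2 ^ n" for i
      using A[of i] that by (cases "i = 2 ^ n") auto
    then show ?thesis by blast
  next
    case False
    have "(b (p + i) \<noteq> s) = tm i" if i: "i \<le> 2 ^ Suc n" for i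
    proof (cases "i \<le> 2 ^ n")
      case True
      then show ?thesis using st by auto
    next
      case f: False
      define r where "r = i - 2 ^ n"
      then have r: "i = 2 ^ n + r" "r \<le> 2 ^ n" using i f by simp_all
      show ?thesis
      proof (cases "r = 2 ^ n")
        case True
        then have "i = 2 ^ Suc n" using r by simp
        then show ?thesis using False r True tm_power[of "Suc n"] by (simp add: add.assoc del: power_Suc)
      next
        case False
        then have "r < 2 ^ n" using r by auto
        then show ?thesis using A[of r] tm_power_plus[of r n] r by (auto simp: add.assoc)
      qed
    qed
    then show ?thesis by blast
  qed
qed

lemma countable_below_tm:
  "countable {b :: nat \<Rightarrow> bool. \<forall>n s. b n = s \<longrightarrow>
     (\<exists>K<2 ^ N. (\<forall>i<K. (b (n + Suc i) \<noteq> s) = tm (Suc i)) \<and> b (n + Suc K) = s \<and> tm (Suc K))}"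
  (is "countable ?B")
proof -
  \<comment> \<open>A finite prefix \<open>xs\<close> followed by alternating copies of the
    Thue--Morse block of length \<open>2 ^ n\<close> and its complement. There are only countably
    many such parameters.\<close>
  define F where "F = (\<lambda>(n::nat, s, xs::bool list) i. if i < length xs then xs ! i
    else ((s \<noteq> odd ((i - length xs) div 2 ^ n)) \<noteq> tm ((i - length xs) mod 2 ^ n)))"
  have "?B \<subseteq> range F \<union> {\<lambda>_. True, \<lambda>_. False}"
  proof
    fix b assume b: "b \<in> ?B"
    define st where "st n p s \<longleftrightarrow> (\<forall>i\<le>2 ^ n. (b (p + i) \<noteq> s) = tm i)" for n p s
    have C: "\<forall>n s. b n = s \<longrightarrow> (\<exists>K. (\<forall>i<K. (b (n + Suc i) \<noteq> s) = tm (Suc i)) \<and> b (n + Suc K) = s \<and> tm (Suc K))"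
      using b by blast
    \<comment> \<open>An occurrence at level \<open>N\<close> agrees with the Thue--Morse prefix
      through place \<open>2 ^ N\<close>, whereas the strict bound demands a drop by then.\<close>
    have noN: "\<not> st N p s" for p s
    proof
      assume a: "st N p s"
      then have "b p = s" by (auto simp: st_def dest!: spec[of _ 0])
      then obtain K where "K < 2 ^ N" "b (p + Suc K) = s" "tm (Suc K)" using b by blast
      then show False using a by (auto simp: st_def dest!: spec[of _ "Suc K"])
    qed
    show "b \<in> range F \<union> {\<lambda>_. True, \<lambda>_. False}"
    proof (cases "\<exists>p. b p \<noteq> b (Suc p)")
      case False
      then have "b i = b 0" for i by (induction i) auto
      then show ?thesis by (cases "b 0") auto
    next
      case True
      then obtain p where "b p \<noteq> b (Suc p)" by blast
      \<comment> \<open>A change of letter is an occurrence at level 0, the start of the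
        doubling.\<close>
      then have "st 0 p (b p)" by (auto simp: st_def le_Suc_eq)
      then have ex0: "\<exists>p s. st 0 p s" by blast
      have "\<exists>n. (\<exists>p s. st n p s) \<and> \<not> (\<exists>p s. st (Suc n) p s)"
      proof (rule ccontr)
        assume "\<not> ?thesis"
        then have nx: "\<exists>p s. st (Suc n) p s" if "\<exists>p s. st n p s" for n using that by blast
        have "\<exists>p s. st n p s" for n by (induction n) (rule ex0, rule nx)
        then show False using noN by blast
      qed
      then obtain n p s where n: "st n p s" "\<And>p s. \<not> st (Suc n) p s" by blast
      have step: "st n (p + 2 ^ n) (\<not> s)" if "st n p s" for p s
        using block_step[OF C, of n p s] that n(2)[of p s] unfolding st_def by blast
      have all: "st n (p + j * 2 ^ n) (s \<noteq> odd j)" for j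
      proof (induction j)
        case (Suc j)
        from step[OF this] show ?case by (simp add: algebra_simps)
      qed (use n in simp)
      have "b i = F (n, s, map b [0..<p]) i" for i
      proof (cases "i < p")
        case False
        define j r where "j = (i - p) div 2 ^ n" and "r = (i - p) mod 2 ^ n"
        have "j * 2 ^ n + r = i - p" unfolding j_def r_def by (rule div_mult_mod_eq)
        then have "i = p + j * 2 ^ n + r" using False by linarith
        moreover have "r \<le> 2 ^ n" by (simp add: r_def less_imp_le)
        ultimately have "(b i \<noteq> (s \<noteq> odd j)) = tm r" using all[of j] by (auto simp: st_def)
        then show ?thesis using False by (auto simp: F_def j_def r_def)
      qed (auto simp: F_def)
      then have "b = F (n, s, map b [0..<p])" by auto
      then show ?thesis by blast
    qed
  qed
  moreover have "countable (range F \<union> {\<lambda>_. True, \<lambda>_. False})" by auto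
  ultimately show ?thesis using countable_subset by blast
qed

text \<open>The summands \<open>3 * 16 ^ j\<close> have even binary digit sum, so \<open>fam B\<close> below is the Thue--Morse sequence
  shifted by the infinite (\<open>2\<close>-adic) number whose digits are given by \<open>B\<close>.\<close>

definition anum :: "nat set \<Rightarrow> nat \<Rightarrow> nat" where
  "anum B l = (\<Sum>j<l. if j \<in> B then 3 * 16 ^ j else 0)"

lemma anum_Suc: "anum B (Suc l) = anum B l + (if l \<in> B then 3 * 16 ^ l else 0)"
  by (simp add: anum_def)

text \<open>If all summands are present, the sum is \<open>(16 ^ l - 1) / 5\<close>. The remaining
  four fifths of the window of size \<open>16 ^ l\<close> are room for the index of a
  letter.\<close>

lemma anum_bound: "5 * anum B l < 16 ^ l"
  by (induction l) (auto simp: anum_Suc, simp add: anum_def)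

lemma anum_stable: "anum B l + i < 16 ^ l \<Longrightarrow> tm (anum B (l + d) + i) = tm (anum B l + i)"
proof (induction d)
  case (Suc d)
  have "anum B (l + d) + i < 16 ^ (l + d)"
  proof (cases d)
    case 0
    then show ?thesis using Suc by simp
  next
    case (Suc e)
    have "16 ^ (l + d) = 16 * 16 ^ e * (16::nat) ^ l" using Suc by (simp add: power_add)
    moreover have "1 * 16 ^ l \<le> 16 ^ e * (16::nat) ^ l" by (intro mult_right_mono) auto
    ultimately have "16 * 16 ^ l \<le> (16::nat) ^ (l + d)" by linarith
    moreover have "5 * anum B (l + d) < 16 ^ (l + d)" by (rule anum_bound)
    ultimately show ?thesis using Suc.prems by linarith
  qed
  moreover have "(16::nat) ^ (l + d) = 2 ^ (4 * (l + d))" by (subst power_mult) simp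
  ultimately have "tm (3 * 16 ^ (l + d) + (anum B (l + d) + i)) = tm (anum B (l + d) + i)"
    using tm_power_add[of "anum B (l + d) + i" "4 * (l + d)" 3] by simp
  then show ?case using Suc by (simp add: anum_Suc algebra_simps)
qed simp

text \<open>Level \<open>Suc i\<close> already keeps \<open>anum B (Suc i) + i\<close> below
  \<open>16 ^ Suc i\<close>, so later elements of \<open>B\<close> no longer affect letter
  \<open>i\<close>.\<close>

definition fam :: "nat set \<Rightarrow> nat \<Rightarrow> bool" where
  "fam B i = tm (anum B (Suc i) + i)"

lemma less_16_power: "16 * n < (16::nat) ^ Suc n"
proof -
  have "n < 2 ^ n" "(2::nat) ^ n \<le> 16 ^ n" by (rule less_exp) (simp add: power_mono)
  then have "n < 16 ^ n" by (rule less_le_trans)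
  then show ?thesis by simp
qed

lemma fam_eq:
  assumes "anum B l + i < 16 ^ l"
  shows "fam B i = tm (anum B l + i)"
proof (cases "l \<le> Suc i")
  case True
  then show ?thesis using anum_stable[OF assms, of "Suc i - l"] by (simp add: fam_def)
next
  case False
  have "anum B (Suc i) + i < 16 ^ Suc i" using anum_bound[of B "Suc i"] less_16_power[of i] by linarith
  from anum_stable[OF this, of "l - Suc i"] show ?thesis using False by (simp add: fam_def)
qed

text \<open>Seen at level \<open>l\<close>, the tail is the Thue--Morse tail at the positive place
  \<open>n\<close>. The bound \<open>K < 2 * n\<close> keeps the whole comparison inside the window
  of size \<open>16 ^ l\<close>.\<close>

lemma fam_tail_less:
  assumes "p > 0"
  shows "\<exists>K. (\<forall>i<K. (fam B (p + Suc i) \<noteq> s) = tm (Suc i)) \<and> fam B (p + Suc K) = s \<and> tm (Suc K)"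
proof -
  define l where "l = Suc p"
  define n where "n = anum B l + p"
  have n: "n > 0" using assms by (simp add: n_def)
  then obtain K where K: "K < max 1 (2 * n)" "\<forall>i<K. (tm (n + Suc i) \<noteq> s) = tm (Suc i)"
    "tm (n + Suc K) = s" "tm (Suc K)" using tm_tail_less by blast
  have "Suc K \<le> 2 * n" using K(1) n by (simp add: max_def split: if_splits)
  define X A where "X = (16::nat) ^ l" and "A = anum B l"
  have "5 * A < X" unfolding X_def A_def by (rule anum_bound)
  moreover have "16 * p < X" unfolding X_def l_def by (rule less_16_power)
  moreover have "n = A + p" by (simp add: n_def A_def)
  ultimately have "n + Suc K < X" using \<open>Suc K \<le> 2 * n\<close> by linarith
  then have b: "n + Suc K < 16 ^ l" by (simp only: X_def)
  have "fam B (p + Suc i) = tm (n + Suc i)" if "i \<le> K" for i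
    using fam_eq[of B l "p + Suc i"] b that by (auto simp: n_def add.assoc)
  then show ?thesis using K by (intro exI[of _ K]) auto
qed

lemma fam_inj:
  assumes eq: "\<forall>i\<ge>2::nat. (fam B i = fam B (Suc i)) = (fam B' i = fam B' (Suc i))"
  shows "B = B'"
proof -
  have an: "anum B l = anum B' l" for l
  proof (cases l)
    case 0
    then show ?thesis by (simp add: anum_def)
  next
    case (Suc k)
    \<comment> \<open>Then \<open>2 ^ a = 4 * 16 ^ k\<close> exceeds both shifts, so residues
      determine them, while the \<open>8 * 16 ^ k\<close> places needed for recognition still fit
      below \<open>16 ^ l = 16 * 16 ^ k\<close>.\<close>
    define a where "a = 4 * k + 2"
    have a: "(2::nat) ^ a = 4 * 16 ^ k" "(16::nat) ^ l = 16 * 16 ^ k" by (simp_all add: a_def Suc power_add power_mult)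
    have bd: "5 * anum B l < 16 ^ l" "5 * anum B' l < 16 ^ l" "(1::nat) \<le> 16 ^ k" using anum_bound by auto
    have "(anum B l + 2) mod 2 ^ a = (anum B' l + 2) mod 2 ^ a"
    proof (rule tm_recognizable, intro allI impI)
      fix i :: nat assume i: "i < 2 * 2 ^ a"
      have w: "anum X l + (2 + Suc i) < 16 ^ l" "anum X l + (2 + i) < 16 ^ l" if "5 * anum X l < 16 ^ l" for X
        using that i a bd(3) by linarith+
      show "(tm (anum B l + 2 + i) = tm (anum B l + 2 + Suc i)) = (tm (anum B' l + 2 + i) = tm (anum B' l + 2 + Suc i))"
        using eq[rule_format, of "2 + i"] fam_eq[OF w(1)[OF bd(1)]] fam_eq[OF w(2)[OF bd(1)]]
          fam_eq[OF w(1)[OF bd(2)]] fam_eq[OF w(2)[OF bd(2)]] by (simp add: add.assoc)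
    qed
    then have "(anum B l + 2 + (2 ^ a - 2)) mod 2 ^ a = (anum B' l + 2 + (2 ^ a - 2)) mod 2 ^ a"
      by (rule mod_add_cong) simp
    moreover have "x + 2 + (2 ^ a - 2) = x + 2 ^ a" for x :: nat
      using a(1) bd(3) by linarith
    ultimately have "anum B l mod 2 ^ a = anum B' l mod 2 ^ a" by (simp only: mod_add_self2)
    moreover have "anum B l < 2 ^ a" "anum B' l < 2 ^ a" using bd a by linarith+
    ultimately show ?thesis by simp
  qed
  show ?thesis
  proof (rule set_eqI)
    fix j
    show "j \<in> B \<longleftrightarrow> j \<in> B'" using an[of "Suc j"] an[of j] by (auto simp: anum_Suc split: if_splits)
  qed
qed

section \<open>Coding digit sequences by binary sequences\<close>

text \<open>\<open>code m tm i\<close> is \<open>\<lambda>\<^sub>i\<^sub>+\<^sub>1(m)\<close>, and complementing \<open>b\<close> reflects the digits \<open>\<epsilon>\<close> to \<open>m - \<epsilon>\<close>. For even \<open>m\<close> the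
  subtraction is not truncated as soon as \<open>m > 0\<close>.\<close>

definition code :: "nat \<Rightarrow> (nat \<Rightarrow> bool) \<Rightarrow> nat \<Rightarrow> nat" where
  "code m b i = (if even m then m div 2 + of_bool (b (Suc i)) - of_bool (b i)
     else m div 2 + of_bool (b (Suc i)))"

lemma code_shift: "code m b (p + i) = code m (\<lambda>i. b (p + i)) i"
  by (simp add: code_def)

lemma code_bounds:
  assumes "m \<ge> 2"
  shows "code m b i \<le> Suc (m div 2)" "code m b i \<le> m"
proof -
  show "code m b i \<le> Suc (m div 2)" by (auto simp: code_def of_bool_def)
  moreover have "Suc (m div 2) \<le> m" using assms by presburger
  ultimately show "code m b i \<le> m" by linarith
qed

lemma code_tm_0: "code m tm 0 = Suc (m div 2)"
  by (simp add: code_def)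

lemma lam_m_code: "m \<ge> 2 \<Longrightarrow> lam_m m (Suc i) = real (code m tm i)"
  by (auto simp: lam_m_def code_def of_bool_tm[symmetric] of_bool_def)

lemma code_complement: "m \<ge> 2 \<Longrightarrow> m - code m b i = code m (\<lambda>i. \<not> b i) i"
  by (auto simp: code_def of_bool_def elim!: evenE oddE)

text \<open>For odd \<open>m\<close> a digit shows a letter. For even \<open>m\<close> it shows an
  increment, and the letters can be summed up only from a known first letter, here that of
  \<open>tm\<close>.\<close>

lemma code_agree:
  assumes m: "m \<ge> 2" and ag: "\<forall>i<K. code m b i = code m tm i" and b0: "odd m \<or> \<not> b 0"
  shows "\<forall>i<K. b (Suc i) = tm (Suc i)"
proof (cases "even m")
  case False
  then show ?thesis using ag by (auto simp: code_def of_bool_def split: if_splits)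
next
  case True
  have "b i = tm i" if "i \<le> K" for i
    using that
  proof (induction i)
    case (Suc i)
    then have "code m b i = code m tm i" "b i = tm i" using ag by auto
    then show ?case using True m by (auto simp: code_def of_bool_def split: if_splits elim!: evenE)
  qed (use b0 True in auto)
  then show ?thesis by auto
qed

text \<open>If \<open>m\<close> is even and \<open>b 0\<close> holds, the first digit is at most
  \<open>m div 2\<close>, which is below the first Thue--Morse digit, and the comparison ends at
  once. Otherwise letters and digits correspond.\<close>

lemma code_lex_le:
  assumes m: "m \<ge> 2" and b: "(\<forall>i<K. b (Suc i) = tm (Suc i)) \<Longrightarrow> b (Suc K) \<Longrightarrow> tm (Suc K)"
    and ag: "\<forall>i<K. code m b i = code m tm i"
  shows "code m b K \<le> code m tm K"
proof (cases "odd m \<or> \<not> b 0")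
  case True
  have A: "\<forall>i<K. b (Suc i) = tm (Suc i)" using code_agree[OF m ag True] .
  have "even m \<Longrightarrow> b K = tm K" using A True by (cases K) auto
  then show ?thesis using b[OF A] by (auto simp: code_def of_bool_def)
next
  case False
  then have "code m b 0 < code m tm 0" using m by (auto simp: code_def of_bool_def)
  then show ?thesis using ag by (cases K) auto
qed

lemma code_lex_less:
  assumes m: "m \<ge> 2" and b: "\<forall>i<K. b (Suc i) = tm (Suc i)" "\<not> b (Suc K)" "tm (Suc K)"
  shows "\<exists>K. code m b K \<noteq> code m tm K"
proof (cases "odd m \<or> \<not> b 0")
  case True
  have "even m \<Longrightarrow> b K = tm K" using b True by (cases K) auto
  then show ?thesis using b m by (intro exI[of _ K]) (auto simp: code_def of_bool_def)
next
  case False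
  then have "code m b 0 < code m tm 0" using m by (auto simp: code_def of_bool_def)
  then show ?thesis by (intro exI[of _ 0]) auto
qed

lemma code_less_imp:
  assumes m: "m \<ge> 2" and ag: "\<forall>i<K. code m b i = code m tm i" and lt: "code m b K < code m tm K"
    and b0: "odd m \<or> \<not> b 0"
  shows "(\<forall>i<K. b (Suc i) = tm (Suc i)) \<and> \<not> b (Suc K) \<and> tm (Suc K)"
proof -
  have A: "\<forall>i<K. b (Suc i) = tm (Suc i)" using code_agree[OF m ag b0] .
  have "even m \<Longrightarrow> b K = tm K" using A b0 by (cases K) auto
  then show ?thesis using A lt m by (auto simp: code_def of_bool_def split: if_splits)
qed

section \<open>Existence and uniqueness of the Thue--Morse base\<close>

lemma lam_m_val:
  assumes "m \<ge> 2" "\<beta> > 1"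
  shows "(\<lambda>i. lam_m m (Suc i) / \<beta> ^ Suc i) sums val \<beta> (code m tm) 0"
  using val_sums[OF assms(2), of "code m tm" m 0] code_bounds(2)[OF assms(1)] by (simp add: lam_m_code[OF assms(1)])

lemma suminf_strict_mono_at:
  fixes f g :: "nat \<Rightarrow> real"
  assumes "summable f" "summable g" "\<And>n. f n \<le> g n" "f i < g i"
  shows "suminf f < suminf g"
proof -
  have "0 < (\<Sum>n. g n - f n)" using assms by (intro suminf_pos2[where i = i] summable_diff) auto
  then show ?thesis using suminf_diff[OF assms(2,1)] by simp
qed

lemma val_code_tm_strict_antimono:
  assumes "m \<ge> 2" "1 < \<beta>" "\<beta> < \<beta>'"
  shows "val \<beta>' (code m tm) 0 < val \<beta> (code m tm) 0"
  unfolding val_def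
proof (rule suminf_strict_mono_at)
  let ?f = "\<lambda>b i. real (code m tm (0 + i)) / b ^ Suc i"
  show "summable (?f \<beta>')" "summable (?f \<beta>)"
    by (rule digits_summable[where m = m]; use assms code_bounds(2)[OF assms(1)] in auto)+
  show "?f \<beta>' i \<le> ?f \<beta> i" for i using assms by (intro divide_left_mono power_mono) auto
  show "?f \<beta>' 0 < ?f \<beta> 0" using assms by (simp add: code_tm_0 divide_strict_left_mono)
qed

text \<open>The constant digit \<open>m\<close> has value 1 in base \<open>m + 1\<close>, and the
  Thue--Morse digit at place 2 is smaller than \<open>m\<close>.\<close>

lemma val_code_tm_max:
  assumes "m \<ge> 2"
  shows "val (real m + 1) (code m tm) 0 < 1"
proof -
  let ?b = "real m + 1"
  have b: "?b > 1" using assms by simp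
  have "(\<Sum>i. real (code m tm (0 + i)) / ?b ^ Suc i) < (\<Sum>i. real m / ?b ^ Suc i)"
  proof (rule suminf_strict_mono_at)
    show "summable (\<lambda>i. real (code m tm (0 + i)) / ?b ^ Suc i)"
      by (rule digits_summable[where m = m]) (use b code_bounds(2)[OF assms(1)] in auto)
    show "summable (\<lambda>i. real m / ?b ^ Suc i)" using geo_sums[OF b] sums_summable by blast
    show "real (code m tm (0 + i)) / ?b ^ Suc i \<le> real m / ?b ^ Suc i" for i
      using code_bounds(2)[OF assms(1)] b by (auto intro!: divide_right_mono simp del: power_Suc)
    have "code m tm 2 < m" using assms tm_3 by (auto simp: code_def of_bool_def numeral_3_eq_3[symmetric])
    then show "real (code m tm (0 + 2)) / ?b ^ Suc 2 < real m / ?b ^ Suc 2"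
      using b by (intro divide_strict_right_mono) (simp_all add: numeral_2_eq_2)
  qed
  also have "\<dots> = 1" using geo_sums[OF b, of "real m"] assms by (simp add: sums_iff)
  finally show ?thesis by (simp only: val_def)
qed

lemma beta_c:
  assumes m: "m \<ge> 2"
  shows "1 < beta_c m" "val (beta_c m) (code m tm) 0 = 1" "beta_c m < real m + 1"
proof -
  let ?f = "\<lambda>b. val b (code m tm) 0"
  let ?P = "\<lambda>\<beta>. \<beta> > 1 \<and> (\<lambda>i. lam_m m (Suc i) / \<beta> ^ Suc i) sums 1"
  have P: "?P \<beta> \<longleftrightarrow> \<beta> > 1 \<and> ?f \<beta> = 1" for \<beta>
    using lam_m_val[OF m, of \<beta>] by (auto simp: sums_iff)
  define k where "k = real (m div 2)"
  have k: "k \<ge> 1" using m by (simp add: k_def)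
  \<comment> \<open>Strictly between 1 and \<open>k + 1\<close>, so that the first digit
    \<open>k + 1\<close> alone contributes more than 1.\<close>
  define lo where "lo = (k + 2) / 2"
  have lo: "1 < lo" "lo < real m + 1" using k m by (auto simp: lo_def k_def field_simps)
  have "1 < (k + 1) / lo" using k by (simp add: lo_def field_simps)
  also have "\<dots> = (\<Sum>i\<in>{0}. real (code m tm (0 + i)) / lo ^ Suc i)" by (simp add: code_tm_0 k_def)
  also have "\<dots> \<le> ?f lo"
    unfolding val_def using lo code_bounds(2)[OF m]
    by (intro sum_le_suminf digits_summable[where m = m]) auto
  finally have flo: "1 < ?f lo" .
  \<comment> \<open>As a power series in \<open>1 / b\<close> the value is continuous in the base,
    as the intermediate value theorem requires.\<close>
  define g where "g z = (\<Sum>i. real (code m tm i) * z ^ i)" for z :: real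
  have fg: "?f b = g (1 / b) / b" if "b > 1" for b
  proof -
    have s: "summable (\<lambda>i. real (code m tm i) / b ^ Suc i)"
      using digits_summable[OF that, of "code m tm" m 0] code_bounds(2)[OF m] by simp
    have "summable (\<lambda>i. (real (code m tm i) / b ^ Suc i) * b)" using s by (rule summable_mult2)
    then have s': "summable (\<lambda>i. real (code m tm i) * (1 / b) ^ i)" using that by (simp add: power_divide)
    have "?f b = (\<Sum>i. (real (code m tm i) * (1 / b) ^ i) / b)"
      unfolding val_def using that by (simp add: power_divide mult.commute)
    then show ?thesis using suminf_divide[OF s', of b] by (simp add: g_def)
  qed
  have cont: "isCont (\<lambda>b. g (1 / b) / b) b" if "b > 1" for b
  proof -
    define c where "c = (1 + b) / 2"
    have c: "1 < c" "c < b" using that by (auto simp: c_def)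
    have "summable (\<lambda>i. (real (code m tm i) / c ^ Suc i) * c)"
      using digits_summable[OF c(1), of "code m tm" m 0] code_bounds(2)[OF m] by (intro summable_mult2) simp
    then have s: "summable (\<lambda>i. real (code m tm i) * (1 / c) ^ i)" using c by (simp add: power_divide)
    have "isCont g (1 / b)" unfolding g_def
      using c by (intro isCont_powser[OF s]) (auto simp: field_simps)
    then have "isCont (\<lambda>b. g (1 / b)) b" using that by (intro isCont_o2[of b "\<lambda>b. 1 / b" g] continuous_intros) auto
    then show ?thesis using that by (intro continuous_intros) auto
  qed
  have "\<exists>b\<ge>lo. b \<le> real m + 1 \<and> g (1 / b) / b = 1"
  proof (rule IVT2)
    have "1 < real m + 1" using m by simp
    from fg[OF this] show "g (1 / (real m + 1)) / (real m + 1) \<le> 1" using val_code_tm_max[OF m] by linarith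
    show "1 \<le> g (1 / lo) / lo" using fg[OF lo(1)] flo by linarith
    show "lo \<le> real m + 1" using lo by simp
    show "\<forall>x. lo \<le> x \<and> x \<le> real m + 1 \<longrightarrow> isCont (\<lambda>b. g (1 / b) / b) x"
      using lo(1) by (intro allI impI cont) linarith
  qed
  then obtain b where b: "b \<ge> lo" "b \<le> real m + 1" "g (1 / b) / b = 1" by blast
  then have b: "b \<ge> lo" "b \<le> real m + 1" "?f b = 1" using fg[of b] lo by simp_all
  have uniq: "x = b" if "?P x" for x
  proof (rule ccontr)
    assume ne: "x \<noteq> b"
    have x: "x > 1" "?f x = 1" using that unfolding P by auto
    show False
    proof (cases "x < b")
      case True
      then show False using val_code_tm_strict_antimono[OF m x(1) True] x b by simp
    next
      case False
      then show False using val_code_tm_strict_antimono[OF m, of b x] x b lo ne by simp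
    qed
  qed
  have "?P b" using P[of b] b lo by linarith
  then have "beta_c m = b" unfolding beta_c_def by (rule the_equality) (rule uniq)
  moreover have "b \<noteq> real m + 1"
  proof
    assume "b = real m + 1"
    then have "val (real m + 1) (code m tm) 0 = 1" using b(3) by (simp only:)
    then show False using val_code_tm_max[OF m] by linarith
  qed
  ultimately show "1 < beta_c m" "val (beta_c m) (code m tm) 0 = 1" "beta_c m < real m + 1"
    using b lo by simp_all
qed

section \<open>Between \<open>beta_f\<close> and \<open>beta_c\<close>\<close>

text \<open>For even \<open>m\<close> a digit sequence below the bound has alternating nonzero entries around \<open>m / 2\<close>, so it
  is the sequence of increments of a binary one.\<close>

lemma ex_code_even:
  fixes d :: "nat \<Rightarrow> int"
  assumes d: "\<forall>i. d i \<in> {-1, 0, 1}"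
    and alt: "\<forall>i. d i \<noteq> 0 \<longrightarrow> d (Suc i) = - d i \<or> (d (Suc i) = 0 \<and> d (Suc (Suc i)) = - d i)"
  shows "\<exists>b. \<forall>i. d i = of_bool (b (Suc i)) - of_bool (b i)"
proof (cases "\<forall>i. d i = 0")
  case True
  then show ?thesis by (intro exI[of _ "\<lambda>_. False"]) auto
next
  case False
  then obtain i0 where i0: "d i0 \<noteq> 0" by blast
  have later: "\<exists>j\<ge>i. d j \<noteq> 0" for i
  proof (induction i)
    case 0
    then show ?case using i0 by blast
  next
    case (Suc i)
    then obtain j where j: "j \<ge> i" "d j \<noteq> 0" by blast
    show ?case
    proof (cases "j = i")
      case True
      then have "d (Suc i) \<noteq> 0 \<or> d (Suc (Suc i)) \<noteq> 0" using alt[rule_format, of i] j by auto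
      then show ?thesis
      proof
        assume "d (Suc i) \<noteq> 0" then show ?thesis by (intro exI[of _ "Suc i"]) simp
      next
        assume "d (Suc (Suc i)) \<noteq> 0" then show ?thesis by (intro exI[of _ "Suc (Suc i)"]) simp
      qed
    qed (use j in \<open>intro exI[of _ j], auto\<close>)
  qed
  define nx where "nx i = (LEAST j. j \<ge> i \<and> d j \<noteq> 0)" for i
  have nx0: "nx i = i" if "d i \<noteq> 0" for i
    unfolding nx_def by (rule Least_equality) (use that in auto)
  have nxS: "nx i = nx (Suc i)" if "d i = 0" for i
  proof -
    have "(j \<ge> i \<and> d j \<noteq> 0) = (j \<ge> Suc i \<and> d j \<noteq> 0)" for j using that by (cases "j = i") auto
    then show ?thesis unfolding nx_def by simp
  qed
  \<comment> \<open>A letter is read off the next nonzero increment: before \<open>-1\<close> it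
    must be \<open>True\<close>, before \<open>1\<close> it must be \<open>False\<close>.\<close>
  define b where "b i \<longleftrightarrow> d (nx i) = -1" for i
  have "d i = of_bool (b (Suc i)) - of_bool (b i)" for i
  proof (cases "d i = 0")
    case True
    then show ?thesis using nxS by (simp add: b_def)
  next
    case False
    have "d (nx (Suc i)) = - d i"
    proof (cases "d (Suc i) = 0")
      case t: True
      then have "d (Suc (Suc i)) = - d i" using alt[rule_format, of i] False by auto
      then show ?thesis using nxS[OF t] nx0[of "Suc (Suc i)"] False by auto
    next
      case f: False
      then have "d (Suc i) = - d i" using alt[rule_format, of i] False by auto
      then show ?thesis using nx0[OF f] by simp
    qed
    then show ?thesis using nx0[OF False] False d[rule_format, of i] by (auto simp: b_def)
  qed
  then show ?thesis by blast
qed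

text \<open>Since the Thue--Morse value exceeds 1, so does some partial sum. The prefix of length
  \<open>2 ^ N\<close>, padded with zeros, then bounds all tails, and a drop below it can only occur
  before place \<open>2 ^ N\<close>. This uniform bound is what the countability of the binary codes
  rests on.\<close>

lemma countable_W:
  assumes m: "m \<ge> 2" and b: "1 < \<beta>" "\<beta> < beta_c m"
  shows "countable (W_bm \<beta> m)"
proof -
  have bm: "\<beta> \<le> real m + 1" using beta_c(3)[OF m] b by simp
  have "1 < val \<beta> (code m tm) 0" using val_code_tm_strict_antimono[OF m b] beta_c(2)[OF m] by simp
  moreover have "(\<lambda>n. \<Sum>i<n. real (code m tm (0 + i)) / \<beta> ^ Suc i) \<longlonglongrightarrow> val \<beta> (code m tm) 0"
    using val_sums[OF b(1), of "code m tm" m 0] code_bounds(2)[OF m] by (auto simp: sums_def)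
  ultimately have "\<forall>\<^sub>F n in sequentially. 1 < (\<Sum>i<n. real (code m tm (0 + i)) / \<beta> ^ Suc i)"
    by (rule order_tendstoD(1)[rotated])
  then obtain n0 where n0: "\<And>n. n \<ge> n0 \<Longrightarrow> 1 < (\<Sum>i<n. real (code m tm i) / \<beta> ^ Suc i)"
    by (auto simp: eventually_sequentially)
  define N where "N = n0 + 2"
  have N: "n0 \<le> 2 ^ N" "3 \<le> (2::nat) ^ N"
    using less_exp[of N] by (auto simp: N_def)
  define \<alpha> where "\<alpha> i = (if i < 2 ^ N then code m tm i else 0)" for i
  have am: "\<forall>i. \<alpha> i \<le> m" using code_bounds(2)[OF m] by (simp add: \<alpha>_def)
  have "1 < (\<Sum>i<2 ^ N. real (code m tm i) / \<beta> ^ Suc i)" using n0 N by simp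
  also have "\<dots> = (\<Sum>i<2 ^ N. real (\<alpha> (0 + i)) / \<beta> ^ Suc i)" by (intro sum.cong) (auto simp: \<alpha>_def)
  also have "\<dots> \<le> val \<beta> \<alpha> 0"
    unfolding val_def using b(1) am by (intro sum_le_suminf digits_summable[where m = m]) auto
  finally have va: "1 \<le> val \<beta> \<alpha> 0" by simp
  define T where "T = {b :: nat \<Rightarrow> bool. \<forall>n s. b n = s \<longrightarrow>
     (\<exists>K<2 ^ N. (\<forall>i<K. (b (n + Suc i) \<noteq> s) = tm (Suc i)) \<and> b (n + Suc K) = s \<and> tm (Suc K))}"
  have lexA: "\<exists>K<2 ^ N. (\<forall>i<K. \<epsilon> (n + i) = code m tm i) \<and> \<epsilon> (n + K) < code m tm K"
    if u: "uorb \<beta> m \<epsilon> \<tau>" for \<epsilon> \<tau> n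
  proof -
    obtain K where K: "\<forall>i<K. \<epsilon> (n + i) = \<alpha> i" "\<epsilon> (n + K) < \<alpha> K"
      using uorb_lex_less[OF b(1) u am va, of n] by blast
    then have "K < 2 ^ N" by (auto simp: \<alpha>_def split: if_splits)
    then show ?thesis using K by (intro exI[of _ K]) (auto simp: \<alpha>_def)
  qed
  have lex0: "\<epsilon> n \<le> Suc (m div 2)" if u: "uorb \<beta> m \<epsilon> \<tau>" for \<epsilon> \<tau> n
  proof -
    obtain K where K: "\<forall>i<K. \<epsilon> (n + i) = code m tm i" "\<epsilon> (n + K) < code m tm K" using lexA[OF u] by blast
    show ?thesis
    proof (cases "K = 0")
      case False
      then have "\<epsilon> (n + 0) = code m tm 0" using K(1) by blast
      then show ?thesis by (simp add: code_tm_0)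
    qed (use K code_tm_0[of m] in auto)
  qed
  have "W_bm \<beta> m \<subseteq> (\<lambda>b. val \<beta> (code m b) 0) ` T"
  proof
    fix x assume "x \<in> W_bm \<beta> m"
    then obtain \<epsilon> \<tau> where u: "uorb \<beta> m \<epsilon> \<tau>" "\<tau> 0 = x" using W_iff[OF b(1) bm] by blast
    have u': "uorb \<beta> m (\<lambda>n. m - \<epsilon> n) (\<lambda>n. real m / (\<beta> - 1) - \<tau> n)" using uorb_reflect[OF b(1) u(1)] .
    have em: "\<epsilon> i \<le> m" for i using u by (auto simp: uorb_def)
    have up: "\<epsilon> i \<le> Suc (m div 2)" for i
      using lex0[OF u(1)] .
    have dn: "m - \<epsilon> i \<le> Suc (m div 2)" for i
      using lex0[OF u'] .
    obtain c where c: "\<epsilon> = code m c" "odd m \<Longrightarrow> \<not> c 0"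
    proof (cases "even m")
      case False
      then obtain k where k: "m = 2 * k + 1" by (auto elim: oddE)
      define c where "c i \<longleftrightarrow> i > 0 \<and> \<epsilon> (i - 1) = Suc (m div 2)" for i
      have "\<epsilon> i = code m c i" for i using up[of i] dn[of i] em[of i] k by (auto simp: code_def c_def)
      then show ?thesis using that[of c] by (auto simp: c_def)
    next
      case True
      then obtain k where k: "m = 2 * k" by blast
      define d where "d i = int (\<epsilon> i) - int k" for i
      have dd: "d i \<in> {-1, 0, 1}" for i using up[of i] dn[of i] em[of i] k by (auto simp: d_def)
      have ct: "code m tm 0 = k + 1" "code m tm (Suc 0) = k" "code m tm (Suc (Suc 0)) = k - 1" "k \<ge> 1"
        using k m tm_3 by (auto simp: code_def of_bool_def numeral_3_eq_3)
      \<comment> \<open>The Thue--Morse digits begin \<open>k + 1, k, k - 1\<close>; a tail below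
        them that starts with \<open>k + 1\<close> must return to \<open>k - 1\<close> within two
        places. Stated for general \<open>d\<close> and \<open>\<delta>\<close> in order to serve
        the reflected digits too.\<close>
      have three: "d (Suc i) = -1 \<or> (d (Suc i) = 0 \<and> d (Suc (Suc i)) = -1)"
        if di: "d i = 1" and lx: "\<exists>K. (\<forall>j<K. \<delta> (i + j) = code m tm j) \<and> \<delta> (i + K) < code m tm K"
          and \<delta>: "\<And>i. int (\<delta> i) = k + d i" "\<And>i. d i \<in> {-1, 0, 1}" for d :: "nat \<Rightarrow> int" and i \<delta>
      proof -
        obtain K where K: "\<forall>j<K. \<delta> (i + j) = code m tm j" "\<delta> (i + K) < code m tm K" using lx by blast
        have d0: "\<delta> i = k + 1" using \<delta>(1)[of i] \<open>d i = 1\<close> by simp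
        consider "K = 0" | "K = 1" | "K = 2" | "K > 2" by linarith
        then show ?thesis
        proof cases
          case 1 then show ?thesis using K(2) d0 ct by simp
        next
          case 2 then have "\<delta> (Suc i) < k" using K(2) ct by simp
          then show ?thesis using \<delta>(1)[of "Suc i"] \<delta>(2)[of "Suc i"] by auto
        next
          case 3
          then have "\<delta> (Suc i) = k" "\<delta> (Suc (Suc i)) < k - 1"
            using K ct by (auto simp: numeral_2_eq_2 dest!: spec[of _ "Suc 0"])
          then show ?thesis using \<delta>(1)[of "Suc i"] \<delta>(1)[of "Suc (Suc i)"] \<delta>(2)[of "Suc (Suc i)"] ct(4) by auto
        next
          case 4
          then have "\<delta> (i + 1) = code m tm 1" "\<delta> (i + 2) = code m tm 2"
            using K(1)[rule_format, of 1] K(1)[rule_format, of 2] by auto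
          then have "\<delta> (Suc i) = k" "\<delta> (Suc (Suc i)) = k - 1" using ct by (simp_all add: numeral_2_eq_2)
          then show ?thesis using \<delta>(1)[of "Suc i"] \<delta>(1)[of "Suc (Suc i)"] ct(4) by auto
        qed
      qed
      have "\<exists>c. \<forall>i. d i = of_bool (c (Suc i)) - of_bool (c i)"
      proof (rule ex_code_even)
        show "\<forall>i. d i \<noteq> 0 \<longrightarrow> d (Suc i) = - d i \<or> (d (Suc i) = 0 \<and> d (Suc (Suc i)) = - d i)"
        proof (intro allI impI)
          fix i assume "d i \<noteq> 0"
          then consider "d i = 1" | "- d i = 1" using dd[of i] by auto
          then show "d (Suc i) = - d i \<or> (d (Suc i) = 0 \<and> d (Suc (Suc i)) = - d i)"
          proof cases
            case 1
            have "\<And>i. int (\<epsilon> i) = int k + d i" by (simp add: d_def)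
            then have "d (Suc i) = -1 \<or> (d (Suc i) = 0 \<and> d (Suc (Suc i)) = -1)"
              using lexA[OF u(1), of i] dd 1 by (intro three[where \<delta> = \<epsilon>]) blast+
            then show ?thesis using 1 by auto
          next
            case 2
            have "\<And>i. int (m - \<epsilon> i) = int k + - d i" using em k by (simp add: d_def of_nat_diff)
            moreover have "\<And>i. - d i \<in> {-1, 0, 1}" using dd by force
            ultimately have "- d (Suc i) = -1 \<or> (- d (Suc i) = 0 \<and> - d (Suc (Suc i)) = -1)"
              using lexA[OF u', of i] 2 by (intro three[where d = "\<lambda>i. - d i" and \<delta> = "\<lambda>n. m - \<epsilon> n"]) blast+
            then show ?thesis using 2 by auto
          qed
        qed
      qed (use dd in auto)
      then obtain c where c: "\<forall>i. d i = of_bool (c (Suc i)) - of_bool (c i)" by blast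
      have "\<epsilon> i = code m c i" for i
      proof -
        have "int (\<epsilon> i) = int k + (of_bool (c (Suc i)) - of_bool (c i))" unfolding c[rule_format, symmetric] d_def by simp
        then show ?thesis using k ct(4) by (cases "c i"; cases "c (Suc i)") (auto simp: code_def)
      qed
      then show ?thesis using that[of c] True by auto
    qed
    have "c \<in> T" unfolding T_def
    proof (intro CollectI allI impI)
      fix n s assume s: "c n = s"
      \<comment> \<open>Normalised to start with \<open>False\<close>. Its digits are those of the
        tail of \<open>\<epsilon>\<close> or of its reflection, depending on
        \<open>s\<close>.\<close>
      define c' where "c' i = (c (n + i) \<noteq> s)" for i
      have c'0: "\<not> c' 0" using s by (simp add: c'_def)
      have "\<exists>K<2 ^ N. (\<forall>i<K. code m c' i = code m tm i) \<and> code m c' K < code m tm K"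
      proof (cases s)
        case True
        then have "c' = (\<lambda>i. \<not> c (n + i))" by (simp add: c'_def fun_eq_iff)
        then have "code m c' i = m - \<epsilon> (n + i)" for i
          using code_complement[OF m, of c "n + i"] c(1) code_shift[of m "\<lambda>i. \<not> c i" n i] by simp
        then show ?thesis using lexA[OF u', of n] by simp
      next
        case False
        then have "c' = (\<lambda>i. c (n + i))" by (simp add: c'_def fun_eq_iff)
        then have "code m c' i = \<epsilon> (n + i)" for i using c(1) code_shift[of m c n i] by simp
        then show ?thesis using lexA[OF u(1), of n] by simp
      qed
      then obtain K where K: "K < 2 ^ N" "\<forall>i<K. code m c' i = code m tm i" "code m c' K < code m tm K" by blast
      from code_less_imp[OF m K(2,3)] c'0 have "(\<forall>i<K. c' (Suc i) = tm (Suc i)) \<and> \<not> c' (Suc K) \<and> tm (Suc K)" by blast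
      then show "\<exists>K<2 ^ N. (\<forall>i<K. (c (n + Suc i) \<noteq> s) = tm (Suc i)) \<and> c (n + Suc K) = s \<and> tm (Suc K)"
        using K(1) by (intro exI[of _ K]) (auto simp: c'_def)
    qed
    moreover have "x = val \<beta> (code m c) 0" using uorb_val[OF b(1) bm u(1)] u(2) c by simp
    ultimately show "x \<in> (\<lambda>b. val \<beta> (code m b) 0) ` T" by blast
  qed
  moreover have "countable T" unfolding T_def by (rule countable_below_tm)
  ultimately show ?thesis using countable_subset by blast
qed

section \<open>Below \<open>beta_f\<close>, and infinitely many points above it\<close>

text \<open>Choosing in each point a digit that leads back into \<open>A\<close> builds an
  admissible orbit. Explicit periodic orbits can thus be verified by finitely many linear identities
  instead of series.\<close>

lemma W_coinduct:
  assumes b: "1 < \<beta>" "\<beta> \<le> real m + 1"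
    and A: "\<And>y. y \<in> A \<Longrightarrow> real m / (\<beta> - 1) - 1 < y \<and> y < 1 \<and> (\<exists>a\<le>m. \<beta> * y - real a \<in> A)"
  shows "A \<subseteq> W_bm \<beta> m"
proof
  fix x assume x: "x \<in> A"
  define f where "f y = (SOME a. a \<le> m \<and> \<beta> * y - real a \<in> A)" for y
  have f: "f y \<le> m \<and> \<beta> * y - real (f y) \<in> A" if "y \<in> A" for y
    unfolding f_def using A[OF that] by (intro someI_ex[of "\<lambda>a. a \<le> m \<and> \<beta> * y - real a \<in> A"]) blast
  define T where "T = rec_nat x (\<lambda>_ y. \<beta> * y - real (f y))"
  have T: "T 0 = x" "T (Suc n) = \<beta> * T n - real (f (T n))" for n by (simp_all add: T_def)
  have TA: "T n \<in> A" for n by (induction n) (use x f T in auto)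
  have "uorb \<beta> m (\<lambda>n. f (T n)) T"
    using A[OF TA] f[OF TA] gap_left[OF b(1), of m] by (auto simp: uorb_def orb_def T)
  then show "x \<in> W_bm \<beta> m" using W_iff[OF b] T(1) by blast
qed

lemma bounded_geometric_zero:
  fixes y \<beta> :: real
  assumes "1 < \<beta>" "\<And>n. \<bar>\<beta> ^ n * y\<bar> \<le> B"
  shows "y = 0"
proof (rule ccontr)
  assume y: "y \<noteq> 0"
  obtain n where "B / \<bar>y\<bar> < \<beta> ^ n" using real_arch_pow[OF assms(1)] by blast
  then have "B < \<beta> ^ n * \<bar>y\<bar>" using y by (simp add: field_simps)
  then show False using assms(2)[of n] assms(1) by (simp add: abs_mult)
qed

section \<open>Small bases, even \<open>m\<close>\<close>

lemma even_centre:
  fixes k :: nat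
  assumes "1 < \<beta>"
  shows "real (2 * k) / (\<beta> - 1) - 1 = real k / (\<beta> - 1) - (1 - real k / (\<beta> - 1))"
    "\<beta> * (real k / (\<beta> - 1)) = real k + real k / (\<beta> - 1)"
proof -
  have "real (2 * k) / (\<beta> - 1) = real k / (\<beta> - 1) + real k / (\<beta> - 1)" by (simp flip: add_divide_distrib)
  then show "real (2 * k) / (\<beta> - 1) - 1 = real k / (\<beta> - 1) - (1 - real k / (\<beta> - 1))" by linarith
qed (use assms in \<open>simp add: field_simps\<close>)

text \<open>With \<open>r\<close> the half-width of the interval, the quadratic inequality says
  \<open>(\<beta> + 1) * r \<le> 1\<close>. A digit differs from \<open>k\<close> by
  \<open>\<beta> * y n - y (Suc n)\<close>, which is therefore less than 1 in size. So all digits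
  are \<open>k\<close>, and boundedness leaves only the centre.\<close>

lemma W_even_singleton:
  fixes k :: nat
  assumes k: "k \<ge> 1" and b: "real k + 1 < \<beta>" and q: "\<beta>\<^sup>2 - (real k + 1) * \<beta> - real k \<le> 0"
  shows "W_bm \<beta> (2 * k) = {real k / (\<beta> - 1)}"
proof -
  let ?c = "real k / (\<beta> - 1)"
  define r where "r = 1 - ?c"
  have b1: "1 < \<beta>" using k b by simp
  have "\<beta> < real k + 2"
  proof (rule ccontr)
    assume "\<not> \<beta> < real k + 2"
    then have "\<beta> * 1 \<le> \<beta> * (\<beta> - (real k + 1))" using b1 by (intro mult_left_mono) auto
    then show False using q b by (simp add: algebra_simps power2_eq_square)
  qed
  then have bm: "\<beta> \<le> real (2 * k) + 1" using k by simp
  have r0: "r > 0" using b b1 by (simp add: r_def field_simps)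
  have "(\<beta> + 1) * (\<beta> - 1 - real k) \<le> \<beta> - 1" using q by (simp add: algebra_simps power2_eq_square)
  then have r1: "(\<beta> + 1) * r \<le> 1" using b1 by (simp add: r_def field_simps)
  have "{?c} \<subseteq> W_bm \<beta> (2 * k)"
  proof (rule W_coinduct[OF b1 bm])
    fix y assume "y \<in> {?c}"
    show "real (2 * k) / (\<beta> - 1) - 1 < y \<and> y < 1 \<and> (\<exists>a\<le>2 * k. \<beta> * y - real a \<in> {?c})"
    proof (intro conjI exI[of _ k])
      have "y = ?c" using \<open>y \<in> {?c}\<close> by simp
      then show "real (2 * k) / (\<beta> - 1) - 1 < y" "y < 1"
        using even_centre(1)[OF b1, of k] r0 unfolding r_def by linarith+
      show "\<beta> * y - real k \<in> {?c}" unfolding \<open>y = ?c\<close> even_centre(2)[OF b1, of k] by simp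
    qed simp
  qed
  moreover have "x = ?c" if hx: "x \<in> W_bm \<beta> (2 * k)" for x
  proof -
    obtain \<epsilon> \<tau> where u: "uorb \<beta> (2 * k) \<epsilon> \<tau>" "\<tau> 0 = x" using hx W_iff[OF b1 bm] by blast
    define y where "y n = \<tau> n - ?c" for n
    have yr: "\<bar>y n\<bar> < r" for n
    proof -
      have "?c - r < \<tau> n" "\<tau> n < 1"
        using u(1) gap_left[OF b1, of "2 * k"] even_centre(1)[OF b1, of k] unfolding uorb_def r_def by metis+
      then show ?thesis by (simp add: y_def r_def abs_less_iff)
    qed
    have ys: "y (Suc n) = \<beta> * y n - (real (\<epsilon> n) - real k)" for n
    proof -
      have "\<beta> * \<tau> n = real (\<epsilon> n) + \<tau> (Suc n)" using u(1) by (simp add: uorb_def orb_def)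
      then show ?thesis using even_centre(2)[OF b1, of k] by (simp add: y_def algebra_simps)
    qed
    have "real (\<epsilon> n) = real k" for n
    proof -
      have "\<bar>real (\<epsilon> n) - real k\<bar> = \<bar>\<beta> * y n - y (Suc n)\<bar>" using ys[of n] by simp
      also have "\<dots> \<le> \<beta> * \<bar>y n\<bar> + \<bar>y (Suc n)\<bar>" using b1 abs_triangle_ineq4[of "\<beta> * y n" "y (Suc n)"] by (simp add: abs_mult)
      also have "\<dots> < \<beta> * r + r" using yr b1 by (intro add_strict_mono mult_strict_left_mono) auto
      also have "\<dots> \<le> 1" using r1 by (simp add: algebra_simps)
      finally have "real (\<epsilon> n) < real (k + 1)" "real k < real (\<epsilon> n + 1)" unfolding of_nat_add by linarith+
      then have "\<epsilon> n = k" unfolding of_nat_less_iff by linarith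
      then show ?thesis by simp
    qed
    then have "y (Suc n) = \<beta> * y n" for n using ys by simp
    then have eq: "y n = \<beta> ^ n * y 0" for n by (induction n) auto
    have "\<bar>\<beta> ^ n * y 0\<bar> \<le> r" for n using yr[of n] by (subst eq[symmetric]) simp
    then have "y 0 = 0" by (rule bounded_geometric_zero[OF b1])
    then show ?thesis using u(2) by (simp add: y_def)
  qed
  ultimately show ?thesis by blast
qed

text \<open>The points at distance \<open>t\<close> on either side of the centre are exchanged by
  the digits \<open>k + 1\<close> and \<open>k - 1\<close>; the quadratic inequality says that
  \<open>t\<close> is less than the half-width. The points \<open>z n\<close> reach this cycle after
  \<open>n\<close> digits \<open>k\<close>.\<close>

lemma W_even_infinite:
  fixes k :: nat
  assumes k: "k \<ge> 1" and b: "1 < \<beta>" "\<beta> \<le> real (2 * k) + 1"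
    and q: "\<beta>\<^sup>2 - (real k + 1) * \<beta> - real k > 0"
  shows "infinite (W_bm \<beta> (2 * k))"
proof -
  let ?c = "real k / (\<beta> - 1)"
  define t where "t = 1 / (\<beta> + 1)"
  define z where "z n = ?c + t / \<beta> ^ n" for n :: nat
  have t: "t > 0" "t < 1 - ?c" "\<beta> * t = 1 - t"
  proof -
    have "\<beta> - 1 < (\<beta> + 1) * (\<beta> - 1 - real k)" using q by (simp add: algebra_simps power2_eq_square)
    then show "t < 1 - ?c" using b by (simp add: t_def field_simps)
  qed (use b in \<open>simp_all add: t_def field_simps\<close>)
  have zt: "0 < t / \<beta> ^ n" "t / \<beta> ^ n \<le> t" for n
    using b t(1) by (auto simp: divide_le_eq mult_le_cancel_left1)
  have "range z \<union> {?c - t} \<subseteq> W_bm \<beta> (2 * k)"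
  proof (rule W_coinduct[OF b])
    fix y assume y: "y \<in> range z \<union> {?c - t}"
    have "\<bar>y - ?c\<bar> \<le> t"
      using y
    proof
      assume "y \<in> range z"
      then obtain n where "y = z n" by blast
      then show ?thesis using zt[of n] by (simp add: z_def)
    qed (use t(1) in simp)
    then have B: "real (2 * k) / (\<beta> - 1) - 1 < y \<and> y < 1"
      using even_centre(1)[OF b(1), of k] t(2) by linarith
    have zc: "\<exists>n. y = z (Suc n)" if "y \<in> range z" "y \<noteq> z 0"
      using that by (metis imageE not0_implies_Suc)
    then consider n where "y = z (Suc n)" | "y = z 0" | "y = ?c - t" using y by blast
    then have "\<exists>a\<le>2 * k. \<beta> * y - real a \<in> range z \<union> {?c - t}"
    proof cases
      case 1
      then have "\<beta> * y - real k = z n" using even_centre(2)[OF b(1), of k] b by (simp add: z_def algebra_simps)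
      then show ?thesis by (intro exI[of _ k]) auto
    next
      case 2
      then have "\<beta> * y - real (k + 1) = ?c - t" using even_centre(2)[OF b(1), of k] t(3) by (simp add: z_def algebra_simps)
      then show ?thesis using k by (intro exI[of _ "k + 1"]) auto
    next
      case 3
      have "\<beta> * y - real (k - 1) = \<beta> * ?c - \<beta> * t - (real k - 1)" using k by (simp add: 3 of_nat_diff right_diff_distrib)
      also have "\<dots> = z 0" unfolding even_centre(2)[OF b(1), of k] t(3) by (simp add: z_def)
      finally have "\<beta> * y - real (k - 1) = z 0" .
      then show ?thesis using k by (intro exI[of _ "k - 1"]) auto
    qed
    then show "real (2 * k) / (\<beta> - 1) - 1 < y \<and> y < 1 \<and> (\<exists>a\<le>2 * k. \<beta> * y - real a \<in> range z \<union> {?c - t})"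
      using B by blast
  qed
  moreover have "inj z" using b t(1) by (auto simp: inj_def z_def)
  ultimately have "infinite (range z)" "range z \<subseteq> W_bm \<beta> (2 * k)" using range_inj_infinite by auto
  then show ?thesis using finite_subset by blast
qed

lemma beta_f_even:
  fixes k :: nat
  assumes "0 < \<beta>" "k \<ge> 1"
  shows "\<beta> \<le> beta_f (2 * k) \<longleftrightarrow> \<beta>\<^sup>2 - (real k + 1) * \<beta> - real k \<le> 0"
proof -
  let ?s = "sqrt (real k ^ 2 + 6 * real k + 1)"
  have s: "?s\<^sup>2 = real k ^ 2 + 6 * real k + 1" by simp
  have "(real k + 1)\<^sup>2 < ?s\<^sup>2" unfolding s using assms by (simp add: power2_eq_square algebra_simps)
  then have s1: "real k + 1 < ?s" by (rule power_less_imp_less_base) simp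
  have e: "4 * (\<beta>\<^sup>2 - (real k + 1) * \<beta> - real k) = (2 * \<beta> - (real k + 1) - ?s) * (2 * \<beta> - (real k + 1) + ?s)"
    using s by (simp add: algebra_simps power2_eq_square)
  have p: "2 * \<beta> - (real k + 1) + ?s > 0" using s1 assms by linarith
  have "\<beta> \<le> beta_f (2 * k) \<longleftrightarrow> 2 * \<beta> - (real k + 1) - ?s \<le> 0" by (simp add: beta_f_def Let_def field_simps)
  also have "\<dots> \<longleftrightarrow> (2 * \<beta> - (real k + 1) - ?s) * (2 * \<beta> - (real k + 1) + ?s) \<le> 0"
    using p by (simp add: mult_le_0_iff)
  finally show ?thesis unfolding e[symmetric] by (simp only: mult_le_0_iff) simp
qed

section \<open>Small bases, odd \<open>m\<close>\<close>

lemma odd_centre: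
  fixes k :: nat and \<beta> :: real
  assumes "1 < \<beta>"
  defines "c \<equiv> (real k + 1 / 2) / (\<beta> - 1)"
  shows "real (2 * k + 1) / (\<beta> - 1) - 1 = c - (1 - c)" "\<beta> * c = real k + 1 / 2 + c"
proof -
  have "real (2 * k + 1) / (\<beta> - 1) = c + c" unfolding c_def by (simp flip: add_divide_distrib)
  then show "real (2 * k + 1) / (\<beta> - 1) - 1 = c - (1 - c)" by linarith
  show "\<beta> * c = real k + 1 / 2 + c" using assms(1) unfolding c_def by (simp add: field_simps)
qed

text \<open>The two points are exchanged by the digits \<open>k + 1\<close> and \<open>k\<close>,
  and \<open>g\<close> puts them inside the interval, \<open>t < r\<close>. The cubic inequality
  amounts to \<open>2 * r * (\<beta>\<^sup>2 + 1) \<le> \<beta> + 1\<close>, which rules out equal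
  consecutive digits.\<close>

lemma W_odd_pair:
  fixes k :: nat
  assumes k: "k \<ge> 1" and b: "real k + 1 < \<beta>" and g: "\<beta>\<^sup>2 - (real k + 1) * \<beta> - (real k + 1) > 0"
    and q: "\<beta> ^ 3 - (real k + 2) * \<beta>\<^sup>2 + \<beta> - (real k + 1) \<le> 0"
  shows "W_bm \<beta> (2 * k + 1) = {(real k + 1 / 2) / (\<beta> - 1) + 1 / (2 * (\<beta> + 1)), (real k + 1 / 2) / (\<beta> - 1) - 1 / (2 * (\<beta> + 1))}"
proof -
  define c where "c = (real k + 1 / 2) / (\<beta> - 1)"
  define t where "t = 1 / (2 * (\<beta> + 1))"
  define r where "r = 1 - c"
  have b1: "1 < \<beta>" using k b by simp
  note oc = odd_centre[OF b1, of k, folded c_def]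
  have b2: "\<beta> \<le> real k + 2"
  proof (rule ccontr)
    assume "\<not> \<beta> \<le> real k + 2"
    then have "0 \<le> \<beta>\<^sup>2 * (\<beta> - (real k + 2))" by (intro mult_nonneg_nonneg) auto
    then show False using q b by (simp add: algebra_simps power2_eq_square power3_eq_cube)
  qed
  have bm: "\<beta> \<le> real (2 * k + 1) + 1" using b2 k by simp
  have t: "t > 0" "\<beta> * t = 1 / 2 - t" "t < r"
  proof -
    have "\<beta> - 1 < (\<beta> + 1) * (2 * (\<beta> - 1) - (2 * real k + 1))" using g by (simp add: algebra_simps power2_eq_square)
    then have "1 / (\<beta> + 1) < (2 * (\<beta> - 1) - (2 * real k + 1)) / (\<beta> - 1)" using b1 by (simp add: field_simps)
    also have "\<dots> = 2 * r" using b1 by (simp add: r_def c_def field_simps)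
    finally have "1 / (\<beta> + 1) < 2 * r" .
    moreover have "1 / (\<beta> + 1) = 2 * t" using b1 by (simp add: t_def field_simps)
    ultimately show "t < r" by linarith
  qed (use b1 in \<open>simp_all add: t_def field_simps\<close>)
  have r2: "2 * r * (\<beta> - 1) = 2 * (\<beta> - 1) - (2 * real k + 1)" using b1 by (simp add: r_def c_def field_simps)
  have r3: "(\<beta> + 1) * r \<le> 3 / 2"
  proof -
    have "0 \<le> \<beta> * (real k + 2 - \<beta>) + real k" using b2 b1 by simp
    then have "(\<beta> + 1) * (2 * r * (\<beta> - 1)) \<le> 3 * (\<beta> - 1)"
      unfolding r2 by (simp add: algebra_simps power2_eq_square)
    then have "((\<beta> + 1) * r) * (2 * (\<beta> - 1)) \<le> (3 / 2) * (2 * (\<beta> - 1))" by (simp add: algebra_simps)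
    then show ?thesis by (rule mult_right_le_imp_le) (use b1 in simp)
  qed
  have r4: "2 * r * (\<beta>\<^sup>2 + 1) \<le> \<beta> + 1"
  proof -
    have "(\<beta>\<^sup>2 + 1) * (2 * r * (\<beta> - 1)) \<le> (\<beta> + 1) * (\<beta> - 1)"
      unfolding r2 using q by (simp add: algebra_simps power2_eq_square power3_eq_cube)
    then have "(2 * r * (\<beta>\<^sup>2 + 1)) * (\<beta> - 1) \<le> (\<beta> + 1) * (\<beta> - 1)" by (simp add: algebra_simps)
    then show ?thesis by (rule mult_right_le_imp_le) (use b1 in simp)
  qed
  have "{c + t, c - t} \<subseteq> W_bm \<beta> (2 * k + 1)"
  proof (rule W_coinduct[OF b1 bm])
    fix y assume y: "y \<in> {c + t, c - t}"
    have "\<beta> * (c + t) - real (k + 1) = c - t" "\<beta> * (c - t) - real k = c + t"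
      using oc(2) t(2) by (simp_all add: algebra_simps)
    then have "\<exists>a\<le>2 * k + 1. \<beta> * y - real a \<in> {c + t, c - t}"
    proof -
      consider "y = c + t" | "y = c - t" using y by blast
      then show ?thesis
      proof cases
        case 1
        have "\<beta> * y - real (k + 1) \<in> {c + t, c - t}"
          unfolding 1 \<open>\<beta> * (c + t) - real (k + 1) = c - t\<close> by blast
        then show ?thesis by (intro exI conjI[rotated]) (assumption, simp)
      next
        case 2
        have "\<beta> * y - real k \<in> {c + t, c - t}"
          unfolding 2 \<open>\<beta> * (c - t) - real k = c + t\<close> by blast
        then show ?thesis by (intro exI conjI[rotated]) (assumption, simp)
      qed
    qed
    moreover have "\<bar>y - c\<bar> = t" using y t(1) by auto
    then have "real (2 * k + 1) / (\<beta> - 1) - 1 < y \<and> y < 1"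
      using oc(1) t(3) unfolding r_def by linarith
    ultimately show "real (2 * k + 1) / (\<beta> - 1) - 1 < y \<and> y < 1 \<and> (\<exists>a\<le>2 * k + 1. \<beta> * y - real a \<in> {c + t, c - t})"
      by blast
  qed
  moreover have "x \<in> {c + t, c - t}" if hx: "x \<in> W_bm \<beta> (2 * k + 1)" for x
  proof -
    obtain \<epsilon> \<tau> where u: "uorb \<beta> (2 * k + 1) \<epsilon> \<tau>" "\<tau> 0 = x" using hx W_iff[OF b1 bm] by blast
    define y where "y n = \<tau> n - c" for n
    define h where "h n = real (\<epsilon> n) - real k - 1 / 2" for n
    have yr: "\<bar>y n\<bar> < r" for n
    proof -
      have "c - r < \<tau> n" "\<tau> n < 1" using u(1) gap_left[OF b1, of "2 * k + 1"] oc(1) unfolding uorb_def r_def by metis+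
      then show ?thesis by (simp add: y_def r_def abs_less_iff)
    qed
    have ys: "y (Suc n) = \<beta> * y n - h n" for n
    proof -
      have "\<beta> * \<tau> n = real (\<epsilon> n) + \<tau> (Suc n)" using u(1) by (simp add: uorb_def orb_def)
      then show ?thesis using oc(2) by (simp add: y_def h_def algebra_simps)
    qed
    have h: "h n = 1 / 2 \<or> h n = - 1 / 2" for n
    proof -
      have "\<bar>h n\<bar> = \<bar>\<beta> * y n - y (Suc n)\<bar>" using ys[of n] by simp
      also have "\<dots> \<le> \<beta> * \<bar>y n\<bar> + \<bar>y (Suc n)\<bar>" using b1 abs_triangle_ineq4[of "\<beta> * y n" "y (Suc n)"] by (simp add: abs_mult)
      also have "\<dots> < \<beta> * r + r" using yr b1 by (intro add_strict_mono mult_strict_left_mono) auto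
      also have "\<dots> \<le> 3 / 2" using r3 by (simp add: algebra_simps)
      finally have "real (\<epsilon> n) < real (k + 2)" "real k < real (\<epsilon> n + 1)" unfolding h_def of_nat_add by (simp_all, linarith+)
      then have "\<epsilon> n = k \<or> \<epsilon> n = k + 1" unfolding of_nat_less_iff by linarith
      then show ?thesis by (auto simp: h_def)
    qed
    \<comment> \<open>Two equal digits in a row would make
      \<open>\<beta>\<^sup>2 * y n - y (Suc (Suc n))\<close> equal to
      \<open>(\<beta> + 1) * h n\<close>, too large for tails within \<open>r\<close> of the
      centre.\<close>
    have alt: "h (Suc n) = - h n" for n
    proof (rule ccontr)
      assume "h (Suc n) \<noteq> - h n"
      then have e: "h (Suc n) = h n" using h[of n] h[of "Suc n"] by auto
      have "\<beta>\<^sup>2 * y n - y (Suc (Suc n)) = (\<beta> + 1) * h n"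
        unfolding ys[of "Suc n"] ys[of n] e by (simp add: algebra_simps power2_eq_square)
      moreover have "\<bar>(\<beta> + 1) * h n\<bar> = (\<beta> + 1) / 2" using h[of n] b1 by (auto simp: abs_mult)
      ultimately have "(\<beta> + 1) / 2 = \<bar>\<beta>\<^sup>2 * y n - y (Suc (Suc n))\<bar>" by (simp only:)
      also have "\<dots> \<le> \<beta>\<^sup>2 * \<bar>y n\<bar> + \<bar>y (Suc (Suc n))\<bar>"
        using abs_triangle_ineq4[of "\<beta>\<^sup>2 * y n" "y (Suc (Suc n))"] by (simp add: abs_mult)
      also have "\<dots> < \<beta>\<^sup>2 * r + r"
        using yr b1 by (intro add_strict_mono mult_strict_left_mono) auto
      finally have "(\<beta> + 1) / 2 < \<beta>\<^sup>2 * r + r" .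
      moreover have "2 * (\<beta>\<^sup>2 * r + r) \<le> \<beta> + 1" using r4 by (simp add: algebra_simps)
      moreover have False if "A / 2 < B" "2 * B \<le> A" for A B :: real using that by simp
      ultimately show False by blast
    qed
    \<comment> \<open>The deviation from the alternating orbit; it is multiplied by
      \<open>\<beta>\<close> in each step and stays bounded, so it vanishes.\<close>
    define s where "s n = y n - h n / (\<beta> + 1)" for n
    have "s (Suc n) = \<beta> * s n" for n using b1 by (simp add: s_def ys alt field_simps)
    then have eq: "s n = \<beta> ^ n * s 0" for n by (induction n) auto
    have bound: "\<bar>s n\<bar> \<le> r + 1" for n
    proof -
      have "\<bar>h n / (\<beta> + 1)\<bar> \<le> 1" using h[of n] b1 by (auto simp: abs_divide)
      then show ?thesis using yr[of n] unfolding s_def by linarith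
    qed
    have "\<bar>\<beta> ^ n * s 0\<bar> \<le> r + 1" for n using bound[of n] by (subst eq[symmetric])
    then have "s 0 = 0" by (rule bounded_geometric_zero[OF b1])
    then have "y 0 = h 0 / (\<beta> + 1)" by (simp add: s_def)
    moreover have "1 / 2 / (\<beta> + 1) = t" "(- 1 / 2) / (\<beta> + 1) = - t" using b1 by (simp_all add: t_def field_simps)
    ultimately have "y 0 = t \<or> y 0 = - t" using h[of 0] by metis
    then show ?thesis using u(2) by (auto simp: y_def)
  qed
  ultimately show ?thesis unfolding c_def[symmetric] t_def[symmetric] by blast
qed

text \<open>Relative to the centre, \<open>v, w, - v, - w\<close> is a cycle with digits
  \<open>k + 1, k + 1, k, k\<close>, and the cubic inequality says \<open>v < r\<close>. Each
  \<open>z n\<close> reaches \<open>v\<close> after \<open>n\<close> repetitions of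
  \<open>k + 1, k\<close>, and the \<open>z n\<close> converge to the point \<open>t\<close> of the
  alternating orbit.\<close>

lemma W_odd_infinite:
  fixes k :: nat
  assumes b: "1 < \<beta>" "\<beta> \<le> real (2 * k + 1) + 1"
    and q: "\<beta> ^ 3 - (real k + 2) * \<beta>\<^sup>2 + \<beta> - (real k + 1) > 0"
  shows "infinite (W_bm \<beta> (2 * k + 1))"
proof -
  define c where "c = (real k + 1 / 2) / (\<beta> - 1)"
  note oc = odd_centre[OF b(1), of k, folded c_def]
  define r where "r = 1 - c"
  define v w t where "v = (\<beta> + 1) / (\<beta>\<^sup>2 + 1) / 2" and "w = (\<beta> - 1) / (\<beta>\<^sup>2 + 1) / 2" and "t = 1 / (\<beta> + 1) / 2"
  define z where "z n = t + (v - t) / \<beta> ^ (2 * n)" for n :: nat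
  have p0: "\<beta>\<^sup>2 + 1 \<noteq> 0" "\<beta> + 1 \<noteq> 0" using b by (auto simp: sum_power2_eq_zero_iff add_nonneg_eq_0_iff)
  have vw: "\<beta> * v - 1 / 2 = w" "\<beta> * w - 1 / 2 = - v" "\<beta> * t - 1 / 2 = - t"
    using p0 by (simp_all add: v_def w_def t_def field_simps power2_eq_square)
  have "v < r"
  proof -
    have r2: "2 * r * (\<beta> - 1) = 2 * (\<beta> - 1) - (2 * real k + 1)" using b by (simp add: r_def c_def field_simps)
    have "(\<beta> + 1) * (\<beta> - 1) < (\<beta>\<^sup>2 + 1) * (2 * r * (\<beta> - 1))"
      unfolding r2 using q by (simp add: algebra_simps power2_eq_square power3_eq_cube)
    then have "(\<beta> + 1) * (\<beta> - 1) < ((\<beta>\<^sup>2 + 1) * (2 * r)) * (\<beta> - 1)" by (simp add: algebra_simps)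
    then have "\<beta> + 1 < (\<beta>\<^sup>2 + 1) * (2 * r)" by (rule mult_right_less_imp_less) (use b in simp)
    then have "(\<beta> + 1) / (\<beta>\<^sup>2 + 1) < 2 * r" by (subst pos_divide_less_eq) (simp_all add: add_nonneg_pos mult.commute)
    moreover have "x / 2 < r" if "x < 2 * r" for x using that by simp
    ultimately show ?thesis unfolding v_def by blast
  qed
  have tv: "0 < t" "t < v" "0 < w" "w < v"
  proof -
    have pos: "0 < \<beta>\<^sup>2 + 1" by (simp add: add_nonneg_pos)
    show "0 < t" "0 < w" "w < v" using b pos by (auto simp: t_def w_def v_def divide_strict_right_mono)
    have "\<beta>\<^sup>2 + 1 < (\<beta> + 1) * (\<beta> + 1)" using b by (simp add: algebra_simps power2_eq_square)
    then have "(\<beta> + 1) / ((\<beta> + 1) * (\<beta> + 1)) < (\<beta> + 1) / (\<beta>\<^sup>2 + 1)"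
      using b pos by (intro divide_strict_left_mono mult_pos_pos) simp_all
    moreover have "(\<beta> + 1) / ((\<beta> + 1) * (\<beta> + 1)) = 1 / (\<beta> + 1)" using b by simp
    ultimately show "t < v" unfolding t_def v_def by (intro divide_strict_right_mono) simp_all
  qed
  have zz: "t < z n" "z n \<le> v" for n
  proof -
    have "0 < (v - t) / \<beta> ^ (2 * n)" "(v - t) / \<beta> ^ (2 * n) \<le> v - t"
      using b tv(2) by (auto simp: divide_le_eq mult_le_cancel_left1)
    then show "t < z n" "z n \<le> v" by (auto simp: z_def)
  qed
  have zS: "\<beta> * (\<beta> * z (Suc n) - 1 / 2) + 1 / 2 = z n" for n
  proof -
    have "\<beta> * (\<beta> * z (Suc n) - 1 / 2) + 1 / 2 = \<beta> * (\<beta> * t - 1 / 2) + 1 / 2 + \<beta> * (\<beta> * ((v - t) / \<beta> ^ (2 * Suc n)))"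
      by (simp add: z_def algebra_simps)
    also have "\<beta> * (\<beta> * t - 1 / 2) + 1 / 2 = t" unfolding vw(3) using vw(3) by simp
    also have "\<beta> * (\<beta> * ((v - t) / \<beta> ^ (2 * Suc n))) = (v - t) / \<beta> ^ (2 * n)" using b by (simp add: field_simps)
    finally show ?thesis by (simp add: z_def)
  qed
  define A where "A = range z \<union> range (\<lambda>n. \<beta> * z (Suc n) - 1 / 2) \<union> {w, - v, - w}"
  have AW: "(\<lambda>y. c + y) ` A \<subseteq> W_bm \<beta> (2 * k + 1)"
  proof (rule W_coinduct[OF b])
    fix x assume "x \<in> (\<lambda>y. c + y) ` A"
    then obtain y where y: "y \<in> A" "x = c + y" by blast
    have bd: "\<bar>y\<bar> \<le> v"
    proof -
      have "- v \<le> \<beta> * z n - 1 / 2 \<and> \<beta> * z n - 1 / 2 \<le> v" for n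
      proof -
        have "\<beta> * t \<le> \<beta> * z n" "\<beta> * z n \<le> \<beta> * v" using zz[of n] b by auto
        then show ?thesis using vw tv by linarith
      qed
      moreover have "- v \<le> z n" "z n \<le> v" for n using zz[of n] tv by auto
      ultimately have "- v \<le> y \<and> y \<le> v" using y(1) tv by (auto simp: A_def)
      then show ?thesis by linarith
    qed
    then have B: "real (2 * k + 1) / (\<beta> - 1) - 1 < x \<and> x < 1"
      using oc(1) \<open>v < r\<close> y(2) unfolding r_def by linarith
    have up: "\<beta> * x - real (k + 1) = c + (\<beta> * y - 1 / 2)" and dn: "\<beta> * x - real k = c + (\<beta> * y + 1 / 2)"
      using oc(2) y(2) by (simp_all add: algebra_simps)
    have z0: "z 0 = v" by (simp add: z_def)
    have zc: "\<exists>n. y = z (Suc n)" if "y \<in> range z" "y \<noteq> z 0"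
      using that by (metis imageE not0_implies_Suc)
    have "\<beta> * y - 1 / 2 \<in> A \<or> \<beta> * y + 1 / 2 \<in> A"
    proof -
      consider n where "y = z (Suc n)" | "y = z 0" | n where "y = \<beta> * z (Suc n) - 1 / 2" | "y = w" | "y = - v" | "y = - w"
      proof -
        from y(1) consider "y \<in> range z" | "y \<in> range (\<lambda>n. \<beta> * z (Suc n) - 1 / 2)" | "y = w" | "y = - v" | "y = - w"
          unfolding A_def by fast
        then show ?thesis using that zc by cases blast+
      qed
      then show ?thesis
      proof cases
        case (3 n)
        then have "\<beta> * y + 1 / 2 = z n" using zS[of n] by (simp only:)
        then show ?thesis unfolding A_def by blast
      next
        case 5
        then have "\<beta> * y + 1 / 2 = - w" using vw(1) by simp
        then show ?thesis by (simp add: A_def)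
      next
        case 6
        then have "\<beta> * y + 1 / 2 = z 0" using vw(2) z0 by simp
        then show ?thesis by (simp add: A_def)
      next
        case (1 n)
        have "\<beta> * z (Suc n) - 1 / 2 \<in> range (\<lambda>n. \<beta> * z (Suc n) - 1 / 2)" by (rule rangeI)
        then show ?thesis unfolding A_def 1 by blast
      next
        case 2
        then have "\<beta> * y - 1 / 2 = w" using vw(1) z0 by simp
        then show ?thesis by (simp add: A_def)
      next
        case 4
        then have "\<beta> * y - 1 / 2 = - v" using vw(2) by simp
        then show ?thesis by (simp add: A_def)
      qed
    qed
    then have "\<exists>a\<le>2 * k + 1. \<beta> * x - real a \<in> (\<lambda>y. c + y) ` A"
    proof
      assume "\<beta> * y - 1 / 2 \<in> A" then show ?thesis using up by (intro exI[of _ "k + 1"]) auto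
    next
      assume "\<beta> * y + 1 / 2 \<in> A" then show ?thesis using dn by (intro exI[of _ k]) auto
    qed
    then show "real (2 * k + 1) / (\<beta> - 1) - 1 < x \<and> x < 1 \<and> (\<exists>a\<le>2 * k + 1. \<beta> * x - real a \<in> (\<lambda>y. c + y) ` A)"
      using B by blast
  qed
  have "inj z" using b tv(2) by (auto simp: inj_def z_def)
  then have "infinite A" using range_inj_infinite by (auto simp: A_def)
  then have "infinite ((\<lambda>y. c + y) ` A)" using finite_imageD[of "\<lambda>y. c + y" A] by (auto simp: inj_on_def)
  then show ?thesis using AW finite_subset by blast
qed

text \<open>The cubic is negative at \<open>k + 1\<close> and increasing from there on. Hence the
  largest root is the only one beyond \<open>k + 1\<close>, and the sign of the cubic decides on
  which side of it a base lies.\<close>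

lemma beta_f_odd:
  fixes k :: nat
  assumes "k \<ge> 1"
  shows "real k + 1 < beta_f (2 * k + 1)"
    and "real k + 1 < \<beta> \<Longrightarrow> \<beta> \<le> beta_f (2 * k + 1) \<longleftrightarrow> \<beta> ^ 3 - (real k + 2) * \<beta>\<^sup>2 + \<beta> - (real k + 1) \<le> 0"
proof -
  define p where "p x = x ^ 3 - (real k + 2) * x\<^sup>2 + x - (real k + 1)" for x :: real
  have mono: "p x < p y" if "real k + 1 \<le> x" "x < y" for x y
  proof -
    have "0 \<le> x * (x - (real k + 1))" "0 \<le> y * (y - (real k + 1))" "0 \<le> (x - 2) * (y - 2)"
      using that assms by (auto intro!: mult_nonneg_nonneg)
    then have "0 < y\<^sup>2 + x * y + x\<^sup>2 - (real k + 2) * (x + y) + 1"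
      using that assms by (simp add: algebra_simps power2_eq_square)
    then have "0 < (y - x) * (y\<^sup>2 + x * y + x\<^sup>2 - (real k + 2) * (x + y) + 1)" using that by simp
    also have "\<dots> = p y - p x" by (simp add: p_def algebra_simps power2_eq_square power3_eq_cube)
    finally show ?thesis by simp
  qed
  have p1: "p (real k + 1) < 0"
  proof -
    have "p (real k + 1) = - ((real k + 1)\<^sup>2)" by (simp add: p_def algebra_simps power2_eq_square power3_eq_cube)
    also have "\<dots> < 0" using assms by simp
    finally show ?thesis .
  qed
  have p2: "p (real k + 2) = 1" by (simp add: p_def algebra_simps power2_eq_square power3_eq_cube)
  have "\<exists>x\<ge>real k + 1. x \<le> real k + 2 \<and> p x = 0"
    using p1 p2 by (intro IVT') (auto simp: p_def intro!: continuous_intros)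
  then obtain \<rho> where \<rho>: "\<rho> \<ge> real k + 1" "p \<rho> = 0" by blast
  have fin: "finite {x. p x = 0}"
  proof -
    have "{x. p x = 0} = {x. poly [:- (real k + 1), 1, - (real k + 2), 1:] x = 0}"
      by (simp add: p_def algebra_simps power2_eq_square power3_eq_cube)
    then show ?thesis using poly_roots_finite[of "[:- (real k + 1), 1, - (real k + 2), 1:]"] by simp
  qed
  have M: "beta_f (2 * k + 1) = Max {x. p x = 0}" by (simp add: beta_f_def Let_def p_def)
  have "Max {x. p x = 0} \<in> {x. p x = 0}" using fin \<rho> by (intro Max_in) auto
  moreover have "\<rho> \<le> Max {x. p x = 0}" using fin \<rho> by (intro Max_ge) auto
  ultimately have f: "p (beta_f (2 * k + 1)) = 0" "real k + 1 \<le> beta_f (2 * k + 1)" using \<rho> unfolding M by auto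
  then show "real k + 1 < beta_f (2 * k + 1)" using p1 by (cases "beta_f (2 * k + 1) = real k + 1") auto
  show "\<beta> \<le> beta_f (2 * k + 1) \<longleftrightarrow> \<beta> ^ 3 - (real k + 2) * \<beta>\<^sup>2 + \<beta> - (real k + 1) \<le> 0" if "real k + 1 < \<beta>"
    using mono[of \<beta> "beta_f (2 * k + 1)"] mono[of "beta_f (2 * k + 1)" \<beta>] f that
    unfolding p_def by (cases "\<beta> = beta_f (2 * k + 1)"; cases "\<beta> < beta_f (2 * k + 1)") auto
qed

text \<open>\<open>G_m (2 * k + 1)\<close> is the positive root of this quadratic, the base at which
  the orbit with digits \<open>k + 1, k\<close> reaches the ends of the interval.\<close>

lemma G_m_odd:
  fixes k :: nat
  assumes "G_m (2 * k + 1) < \<beta>"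
  shows "real k + 1 < \<beta>" "\<beta>\<^sup>2 - (real k + 1) * \<beta> - (real k + 1) > 0"
proof -
  let ?s = "sqrt (real k ^ 2 + 6 * real k + 5)"
  have s: "?s\<^sup>2 = real k ^ 2 + 6 * real k + 5" by simp
  have "(real k + 1)\<^sup>2 < ?s\<^sup>2" unfolding s by (simp add: power2_eq_square algebra_simps)
  then have s1: "real k + 1 < ?s" by (rule power_less_imp_less_base) simp
  have g: "real k + 1 + ?s < 2 * \<beta>" using assms by (simp add: G_m_def Let_def field_simps)
  then show "real k + 1 < \<beta>" using s1 by linarith
  have "0 < (2 * \<beta> - (real k + 1) - ?s) * (2 * \<beta> - (real k + 1) + ?s)"
    using g s1 by (intro mult_pos_pos) linarith+
  also have "\<dots> = 4 * (\<beta>\<^sup>2 - (real k + 1) * \<beta> - (real k + 1))"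
    using s by (simp add: algebra_simps power2_eq_square)
  finally show "\<beta>\<^sup>2 - (real k + 1) * \<beta> - (real k + 1) > 0" by simp
qed

section \<open>Cardinality at \<open>beta_c\<close>\<close>

lemma code_tail_lex_le:
  assumes m: "m \<ge> 2" and b: "(\<forall>i<K. (b (n + Suc i) \<noteq> s) = tm (Suc i)) \<Longrightarrow> (b (n + Suc K) \<noteq> s) \<Longrightarrow> tm (Suc K)"
    and ag: "\<forall>i<K. code m (\<lambda>i. b i \<noteq> s) (n + i) = code m tm i"
  shows "code m (\<lambda>i. b i \<noteq> s) (n + K) \<le> code m tm K"
  unfolding code_shift
  by (rule code_lex_le[OF m]) (use b ag in \<open>simp_all add: code_shift\<close>)

lemma code_complement_fun: "m \<ge> 2 \<Longrightarrow> (\<lambda>i. m - code m b i) = code m (\<lambda>i. b i \<noteq> True)"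
  by (simp add: code_complement)

lemma val_pos:
  assumes "1 < \<beta>" "\<forall>i. \<epsilon> i \<le> m" "0 < \<epsilon> (n + j)"
  shows "0 < val \<beta> \<epsilon> n"
  unfolding val_def
  by (rule suminf_pos2[where i = j]) (use assms digits_summable[OF assms(1,2), of n] in auto)

text \<open>Letters at powers of two are \<open>True\<close> and give positive digits arbitrarily
  far out.\<close>

lemma val_code_tm_pos:
  assumes m: "m \<ge> 2" and b: "1 < \<beta>"
  shows "0 < val \<beta> (code m tm) K"
proof (rule val_pos[OF b])
  show "\<forall>i. code m tm i \<le> m" using code_bounds(2)[OF m] by blast
  have "K < 2 ^ K" by (rule less_exp)
  then have "Suc (K + (2 ^ K - 1 - K)) = 2 ^ K" by linarith
  then have "tm (Suc (K + (2 ^ K - 1 - K)))" by simp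
  then show "0 < code m tm (K + (2 ^ K - 1 - K))" using m by (auto simp: code_def of_bool_def)
qed

lemma W_beta_c_lepoll:
  assumes m: "m \<ge> 2"
  shows "(UNIV :: nat set set) \<lesssim> W_bm (beta_c m) m"
proof -
  let ?b = "beta_c m"
  note bc = beta_c[OF m]
  have bm: "?b \<le> real m + 1" using bc by simp
  \<comment> \<open>The first letter is dropped because the tails of \<open>fam B\<close> are
    controlled from positive places on.\<close>
  define f where "f B i = fam B (Suc i)" for B i
  have am: "\<forall>i. code m tm i \<le> m" and em: "\<forall>i. code m b i \<le> m" for b using code_bounds(2)[OF m] by blast+
  have lt: "\<exists>K. (\<forall>i<K. (f B (n + Suc i) \<noteq> s) = tm (Suc i)) \<and> f B (n + Suc K) = s \<and> tm (Suc K)" for B n s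
    using fam_tail_less[of "Suc n" B s] by (simp add: f_def)
  have less: "val ?b (code m (\<lambda>i. f B i \<noteq> s)) n < 1" for B s n
  proof -
    have "val ?b (code m (\<lambda>i. f B i \<noteq> s)) n < val ?b (code m tm) 0"
    proof (rule lex_le_val(2)[OF bc(1) em am])
      show "val ?b (code m tm) 0 \<le> 1" using bc(2) by simp
      show "\<forall>n K. (\<forall>i<K. code m (\<lambda>i. f B i \<noteq> s) (n + i) = code m tm i) \<longrightarrow> code m (\<lambda>i. f B i \<noteq> s) (n + K) \<le> code m tm K"
      proof (intro allI impI code_tail_lex_le[OF m])
        fix n K assume ag: "\<forall>i<K. (f B (n + Suc i) \<noteq> s) = tm (Suc i)" and ns: "f B (n + Suc K) \<noteq> s"
        obtain K' where K': "\<forall>i<K'. (f B (n + Suc i) \<noteq> s) = tm (Suc i)" "f B (n + Suc K') = s" "tm (Suc K')"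
          using lt[of B n s] by blast
        have "K' \<noteq> K" using ns K'(2) by metis
        moreover have "\<not> K' < K" using ag K'(2,3) by metis
        ultimately have "K < K'" by linarith
        then show "tm (Suc K)" using K'(1) ns by blast
      qed blast
      \<comment> \<open>Strictness: every tail drops below the Thue--Morse letters somewhere, so its
        digits are not the expansion of 1 itself.\<close>
      obtain K where K: "\<forall>i<K. (f B (n + Suc i) \<noteq> s) = tm (Suc i)" "f B (n + Suc K) = s" "tm (Suc K)"
        using lt[of B n s] by blast
      have "\<exists>K. code m (\<lambda>i. f B (n + i) \<noteq> s) K \<noteq> code m tm K"
        by (rule code_lex_less[OF m, where K = K]) (use K in simp_all)
      then show "(\<lambda>i. code m (\<lambda>i. f B i \<noteq> s) (n + i)) \<noteq> code m tm"
        by (auto simp: code_shift fun_eq_iff)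
      show "\<forall>K. 0 < val ?b (code m tm) K" using val_code_tm_pos[OF m bc(1)] by blast
    qed
    then show ?thesis using bc(2) by simp
  qed
  have u: "uorb ?b m (code m (f B)) (val ?b (code m (f B)))" for B
  proof (rule uorb_val_pair[OF bc(1) em])
    show "\<forall>n. val ?b (code m (f B)) n < 1" using less[of B False] by simp
    show "\<forall>n. val ?b (\<lambda>i. m - code m (f B) i) n < 1" using less[of B True] code_complement_fun[OF m] by simp
  qed
  have "inj (\<lambda>B. val ?b (code m (f B)) 0)"
  proof (rule injI)
    fix B B' assume "val ?b (code m (f B)) 0 = val ?b (code m (f B')) 0"
    then have e: "code m (f B) = code m (f B')" using uorb_unique[OF bc(1) bm u em] by metis
    \<comment> \<open>Even \<open>m\<close> yields only the pattern of equal neighbours; odd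
      \<open>m\<close> yields the letters, but only from place 1 on. This common information is
      enough to recover \<open>B\<close>.\<close>
    have "(f B i = f B (Suc i)) = (f B' i = f B' (Suc i))" if "i \<ge> 1" for i
    proof (cases "even m")
      case True
      have "code m (f B) i = code m (f B') i" using e by simp
      then show ?thesis using True m by (auto simp: code_def of_bool_def split: if_splits)
    next
      case False
      have "f B (Suc i) = f B' (Suc i)" for i
        using fun_cong[OF e, of i] False by (auto simp: code_def of_bool_def split: if_splits)
      then show ?thesis using that by (cases i) auto
    qed
    then have "(fam B i = fam B (Suc i)) = (fam B' i = fam B' (Suc i))" if "i \<ge> 2" for i
      using that by (cases i) (auto simp: f_def)
    then show "B = B'" by (intro fam_inj) blast
  qed
  moreover have "range (\<lambda>B. val ?b (code m (f B)) 0) \<subseteq> W_bm ?b m"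
    using W_iff[OF bc(1) bm] u by blast
  ultimately show ?thesis unfolding lepoll_def by blast
qed

text \<open>Distinct reals have distinct lower cuts of rationals.\<close>

lemma real_lepoll_nat_sets: "(UNIV :: real set) \<lesssim> (UNIV :: nat set set)"
proof -
  define f where "f x = {to_nat q | q :: rat. of_rat q < x}" for x :: real
  have "f x \<noteq> f y" if lt: "x < y" for x y
  proof -
    obtain q where q: "x < of_rat q" "of_rat q < y" using of_rat_dense[OF lt] by blast
    then have "to_nat q \<in> f y" "to_nat q \<notin> f x" by (auto simp: f_def)
    then show ?thesis by blast
  qed
  then have "inj f" by (intro injI) (metis linorder_neqE)
  then show ?thesis unfolding lepoll_def by blast
qed

section \<open>Positive Hausdorff dimension above \<open>beta_c\<close>\<close>

text \<open>Provides an exponent that makes the set under \<open>Inf\<close> in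
  \<open>hausdorff_dim\<close> nonempty: \<open>n\<close> intervals of length \<open>1 / n\<close>
  contribute \<open>1 / n\<close> altogether.\<close>

lemma hausdorff_measure_2_eq_0:
  assumes A: "A \<subseteq> {0..1}"
  shows "hausdorff_measure 2 A = 0"
proof -
  have "hausdorff_content 2 \<delta> A \<le> 0 + ennreal e" if \<delta>: "\<delta> > 0" and e: "e > 0" for \<delta> e
  proof -
    obtain n where n: "max (1 / e) (1 / \<delta>) < real n" using reals_Archimedean2 by blast
    have n': "1 / e < real n" "1 / \<delta> < real n" using n by simp_all
    have "0 < 1 / e" using e by simp
    then have n0: "0 < real n" using n'(1) by linarith
    have "1 < real n * e" "1 < real n * \<delta>"
      using n' by (simp_all only: pos_divide_less_eq[OF e] pos_divide_less_eq[OF \<delta>])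
    then have n1: "1 / real n \<le> e" "1 / real n \<le> \<delta>"
      by (simp_all only: pos_divide_le_eq[OF n0] mult.commute less_imp_le)
    define U where "U i = (if i < n then {real i / real n .. real (Suc i) / real n} else {})" for i
    have dU: "diameter (U i) = (if i < n then 1 / real n else 0)" for i
    proof -
      have "real (Suc i) / real n - real i / real n = 1 / real n" using n0 by (simp add: field_simps)
      moreover have "real i / real n \<le> real (Suc i) / real n" using n0 by (intro divide_right_mono) auto
      ultimately show ?thesis by (simp add: U_def diameter_closed_interval)
    qed
    have cov: "A \<subseteq> (\<Union>i. U i)"
    proof
      fix x assume "x \<in> A"
      then have x: "0 \<le> x" "x \<le> 1" using A by auto
      show "x \<in> (\<Union>i. U i)"
      proof (cases "x = 1")
        case True
        then have "x \<in> U (n - 1)" using n0 by (simp add: U_def of_nat_diff)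
        then show ?thesis by blast
      next
        case False
        define i where "i = nat \<lfloor>x * real n\<rfloor>"
        have "0 \<le> x * real n" "x * real n < real n" using x False n0 by auto
        then have i: "real i \<le> x * real n" "x * real n \<le> real (Suc i)" "i < n"
          unfolding i_def by linarith+
        then have "real i / real n \<le> x" "x \<le> real (Suc i) / real n"
          by (simp_all only: pos_divide_le_eq[OF n0] pos_le_divide_eq[OF n0])
        then have "x \<in> U i" using i(3) by (simp add: U_def)
        then show ?thesis by blast
      qed
    qed
    have "hausdorff_content 2 \<delta> A \<le> (\<Sum>i. ennreal (diameter (U i) powr 2))"
      unfolding hausdorff_content_def
    proof (rule INF_lower, intro CollectI conjI allI cov)
      show "bounded (U i)" "diameter (U i) \<le> \<delta>" for i using n1 \<delta> dU[of i] by (auto simp: U_def)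
    qed
    also have "\<dots> = (\<Sum>i<n. ennreal (diameter (U i) powr 2))"
      by (rule suminf_finite) (auto simp: dU)
    also have "\<dots> = (\<Sum>i<n. ennreal ((1 / real n) powr 2))" by (simp add: dU)
    also have "\<dots> = ennreal (real n * (1 / real n) powr 2)" by (simp add: ennreal_mult ennreal_of_nat_eq_real_of_nat)
    also have "real n * (1 / real n) powr 2 = 1 / real n" using n0 by (simp add: powr_numeral power2_eq_square)
    also have "ennreal (1 / real n) \<le> 0 + ennreal e" using n1 by (simp add: ennreal_leI)
    finally show ?thesis .
  qed
  then have "hausdorff_content 2 \<delta> A \<le> 0" if "\<delta> > 0" for \<delta>
    by (rule ennreal_le_epsilon) (use that in blast)
  then have "hausdorff_measure 2 A \<le> 0" unfolding hausdorff_measure_def by (intro SUP_least) simp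
  then show ?thesis by simp
qed

text \<open>A family whose parameter is recovered Hoelder continuously, with exponent \<open>s0\<close>, pushes covers of \<open>A\<close>
  forward to covers of the unit interval.\<close>

lemma hausdorff_dim_ge:
  fixes f g :: "'c \<Rightarrow> real"
  assumes A: "A \<subseteq> {0..1}" and f: "\<And>c. c \<in> S \<Longrightarrow> f c \<in> A" and g: "{0..1} \<subseteq> g ` S"
    and C: "C > 0" and s0: "s0 > 0"
    and H: "\<And>c c'. c \<in> S \<Longrightarrow> c' \<in> S \<Longrightarrow> \<bar>g c - g c'\<bar> \<le> C * \<bar>f c - f c'\<bar> powr s0"
  shows "s0 \<le> hausdorff_dim A"
  unfolding hausdorff_dim_def
proof (rule cInf_greatest)
  show "{s. 0 \<le> s \<and> hausdorff_measure s A = 0} \<noteq> {}" using hausdorff_measure_2_eq_0[OF A] by (auto intro: exI[of _ 2])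
next
  fix s assume s: "s \<in> {s. 0 \<le> s \<and> hausdorff_measure s A = 0}"
  show "s0 \<le> s"
  proof (rule ccontr)
    assume ns: "\<not> s0 \<le> s"
    have "ennreal (1 / (2 * C)) \<le> hausdorff_content s 1 A"
      unfolding hausdorff_content_def
    proof (rule INF_greatest)
      fix U :: "nat \<Rightarrow> real set"
      assume "U \<in> {U. A \<subseteq> (\<Union>i. U i) \<and> (\<forall>i. bounded (U i) \<and> diameter (U i) \<le> 1)}"
      then have U: "A \<subseteq> (\<Union>i. U i)" "\<And>i. bounded (U i)" "\<And>i. diameter (U i) \<le> 1" by auto
      define D where "D i = C * diameter (U i) powr s0" for i
      \<comment> \<open>Covering sets are arbitrary, so their images are enlarged to closed sets,
        which are measurable and to which countable subadditivity of Lebesgue measure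
        applies.\<close>
      have "\<exists>I. closed I \<and> g ` {c \<in> S. f c \<in> U i} \<subseteq> I \<and> emeasure lborel I \<le> ennreal (2 * D i)" for i
      proof (cases "{c \<in> S. f c \<in> U i} = {}")
        case True
        then show ?thesis by (intro exI[of _ "{}"]) auto
      next
        case False
        then obtain c where c: "c \<in> S" "f c \<in> U i" by blast
        have "g c' \<in> {g c - D i .. g c + D i}" if c': "c' \<in> S" "f c' \<in> U i" for c'
        proof -
          have "\<bar>f c - f c'\<bar> \<le> diameter (U i)"
            using diameter_bounded_bound[OF U(2) c(2) c'(2)] by (simp add: dist_real_def)
          then have "C * \<bar>f c - f c'\<bar> powr s0 \<le> D i"
            unfolding D_def using C s0 by (intro mult_left_mono powr_mono2) auto
          then have "\<bar>g c - g c'\<bar> \<le> D i" using H[OF c(1) c'(1)] by linarith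
          then show ?thesis by (simp add: abs_le_iff)
        qed
        moreover have "D i \<ge> 0" using C by (simp add: D_def)
        ultimately show ?thesis by (intro exI[of _ "{g c - D i .. g c + D i}"]) auto
      qed
      then obtain I where I: "\<And>i. closed (I i)" "\<And>i. g ` {c \<in> S. f c \<in> U i} \<subseteq> I i"
        "\<And>i. emeasure lborel (I i) \<le> ennreal (2 * D i)" by metis
      have "{0..1} \<subseteq> (\<Union>i. I i)"
      proof
        fix x :: real assume "x \<in> {0..1}"
        then obtain c where c: "c \<in> S" "x = g c" using g by blast
        then obtain i where "f c \<in> U i" using f U(1) by blast
        then show "x \<in> (\<Union>i. I i)" using I(2)[of i] c by blast
      qed
      then have "emeasure lborel {0..1::real} \<le> emeasure lborel (\<Union>i. I i)"
        using I(1) by (intro emeasure_mono) auto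
      also have "\<dots> \<le> (\<Sum>i. emeasure lborel (I i))"
        using I(1) by (intro emeasure_subadditive_countably) auto
      also have "\<dots> \<le> (\<Sum>i. ennreal (2 * C) * ennreal (diameter (U i) powr s))"
      proof (intro suminf_le allI)
        fix i
        have d0: "0 \<le> diameter (U i)" using U(2) by (rule diameter_ge_0)
        \<comment> \<open>For diameters at most 1 the smaller exponent gives the larger power, hence
          the choice of the content at scale 1.\<close>
        have "diameter (U i) powr s0 \<le> diameter (U i) powr s"
          using d0 U(3)[of i] s ns by (intro powr_mono') auto
        then have "2 * D i \<le> (2 * C) * diameter (U i) powr s" using C by (simp add: D_def)
        then show "emeasure lborel (I i) \<le> ennreal (2 * C) * ennreal (diameter (U i) powr s)"
          using I(3)[of i] C by (simp add: ennreal_mult[symmetric] order_trans[OF _ ennreal_leI])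
      qed auto
      also have "\<dots> = ennreal (2 * C) * (\<Sum>i. ennreal (diameter (U i) powr s))" by simp
      finally have "1 \<le> ennreal (2 * C) * (\<Sum>i. ennreal (diameter (U i) powr s))" by simp
      then have "ennreal (1 / (2 * C)) * 1 \<le> ennreal (1 / (2 * C)) * (ennreal (2 * C) * (\<Sum>i. ennreal (diameter (U i) powr s)))"
        by (rule mult_left_mono) simp
      also have "\<dots> = (\<Sum>i. ennreal (diameter (U i) powr s))"
        using C by (simp add: mult.assoc[symmetric] ennreal_mult[symmetric])
      finally show "ennreal (1 / (2 * C)) \<le> (\<Sum>i. ennreal (diameter (U i) powr s))" by simp
    qed
    also have "\<dots> \<le> hausdorff_measure s A" unfolding hausdorff_measure_def by (rule SUP_upper) simp
    also have "\<dots> = 0" using s by simp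
    finally show False using C by simp
  qed
qed

lemma W_subset_unit:
  assumes "1 < \<beta>" "\<beta> \<le> real m + 1"
  shows "W_bm \<beta> m \<subseteq> {0..1}"
proof
  fix x assume "x \<in> W_bm \<beta> m"
  then have "(real m + 1 - \<beta>) / (\<beta> - 1) < x" "x < 1" by (auto simp: W_bm_def)
  moreover have "0 \<le> (real m + 1 - \<beta>) / (\<beta> - 1)" using assms by simp
  ultimately show "x \<in> {0..1}" by simp
qed

text \<open>All tails of the substituted sequences lie between \<open>C0 - \<rho>\<close> and
  \<open>\<rho>\<close>, strictly inside the interval. This margin keeps two expansions apart, by an
  amount fixed by the place of their first difference.\<close>

lemma hausdorff_dim_W_pos:
  assumes m: "m \<ge> 2" and b: "beta_c m < \<beta>" "\<beta> \<le> real m + 1"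
  shows "hausdorff_dim (W_bm \<beta> m) > 0"
proof -
  have b1: "1 < \<beta>" using beta_c(1)[OF m] b by simp
  have em: "\<forall>i. code m b i \<le> m" for b using code_bounds(2)[OF m] by blast
  define a where "a = val \<beta> (code m tm) 0"
  have a1: "a < 1" using val_code_tm_strict_antimono[OF m beta_c(1)[OF m] b(1)] beta_c(2)[OF m] by (simp add: a_def)
  define C0 where "C0 = real m / (\<beta> - 1)"
  have C0: "1 \<le> C0" using b b1 by (simp add: C0_def field_simps)
  \<comment> \<open>After \<open>q\<close> digits, any change of the remaining ones moves the value
    by less than \<open>1 - a\<close>.\<close>
  obtain q where q: "C0 / (1 - a) < \<beta> ^ q" using real_arch_pow[OF b1] by blast
  define n where "n = Suc q"
  define M where "M = (2::nat) ^ n"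
  have M: "q < M" "0 < M" using less_exp[of n] by (auto simp: M_def n_def)
  \<comment> \<open>Only the first \<open>M - 1\<close> letters of a substituted sequence are
    controlled; the filling with the largest digit makes all later comparisons trivial.\<close>
  define \<alpha> where "\<alpha> i = (if Suc i < M then code m tm i else m)" for i
  have am: "\<forall>i. \<alpha> i \<le> m" using em by (simp add: \<alpha>_def)
  define \<rho> where "\<rho> = val \<beta> \<alpha> 0"
  have rho: "\<rho> < 1"
  proof -
    have "\<rho> - a = (val \<beta> \<alpha> (0 + (M - 1)) - val \<beta> (code m tm) (0 + (M - 1))) / \<beta> ^ (M - 1)"
      unfolding \<rho>_def a_def by (rule orb_agree[OF b1 val_orb[OF b1 am] val_orb[OF b1 em]]) (auto simp: \<alpha>_def less_diff_conv)
    also have "\<dots> \<le> C0 / \<beta> ^ (M - 1)"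
      using val_bounds[OF b1 am, of "0 + (M - 1)"] val_bounds[OF b1 em[of tm], of "0 + (M - 1)"] b1
      unfolding C0_def by (intro divide_right_mono) auto
    also have "\<dots> \<le> C0 / \<beta> ^ q"
      using b1 C0 M by (intro divide_left_mono power_increasing mult_pos_pos) auto
    also have "\<dots> < 1 - a" using q a1 b1 by (simp add: field_simps)
    finally show ?thesis by simp
  qed
  define e where "e c = code m (dbl n c)" for c
  have bd: "val \<beta> (code m (\<lambda>i. dbl n c i \<noteq> s)) p \<le> \<rho>" for c s p
    unfolding \<rho>_def
  proof (rule lex_le_val(1)[OF b1 em am])
    show "val \<beta> \<alpha> 0 \<le> 1" using rho by (simp add: \<rho>_def)
    show "\<forall>p K. (\<forall>i<K. code m (\<lambda>i. dbl n c i \<noteq> s) (p + i) = \<alpha> i) \<longrightarrow> code m (\<lambda>i. dbl n c i \<noteq> s) (p + K) \<le> \<alpha> K"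
    proof (intro allI impI)
      fix p K assume ag: "\<forall>i<K. code m (\<lambda>i. dbl n c i \<noteq> s) (p + i) = \<alpha> i"
      show "code m (\<lambda>i. dbl n c i \<noteq> s) (p + K) \<le> \<alpha> K"
      proof (cases "Suc K < M")
        case True
        then have "code m (\<lambda>i. dbl n c i \<noteq> s) (p + K) \<le> code m tm K"
          using ag dbl_prefix_le[of K n c p s] by (intro code_tail_lex_le[OF m]) (auto simp: \<alpha>_def M_def)
        then show ?thesis using True by (simp add: \<alpha>_def)
      qed (use em in \<open>simp add: \<alpha>_def\<close>)
    qed
  qed
  have val_e: "val \<beta> (e c) p \<le> \<rho>" "val \<beta> (\<lambda>i. m - e c i) p \<le> \<rho>" for c p
    using bd[of c False p] bd[of c True p] code_complement_fun[OF m, of "dbl n c"] by (simp_all add: e_def)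
  have u: "uorb \<beta> m (e c) (val \<beta> (e c))" for c
  proof (rule uorb_val_pair[OF b1])
    show "\<forall>i. e c i \<le> m" using em by (simp add: e_def)
    show "\<forall>p. val \<beta> (e c) p < 1" "\<forall>p. val \<beta> (\<lambda>i. m - e c i) p < 1" using val_e rho by (meson le_less_trans)+
  qed
  have low: "C0 - \<rho> \<le> val \<beta> (e c) p" for c p
  proof -
    have "uorb \<beta> m (\<lambda>i. m - e c i) (\<lambda>i. C0 - val \<beta> (e c) i)" using uorb_reflect[OF b1 u] by (simp add: C0_def)
    from uorb_val[OF b1 b(2) this] have "C0 - val \<beta> (e c) p = val \<beta> (\<lambda>i. m - e c i) p" by metis
    then show ?thesis using val_e(2)[of c p] by linarith
  qed
  \<comment> \<open>The first letter is fixed: \<open>g\<close> reads only the later ones, and a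
    first difference at a place \<open>j > 0\<close> shows up in the digit at
    \<open>M * j - 1\<close>.\<close>
  define S where "S = {c :: nat \<Rightarrow> bool. \<not> c 0}"
  define h where "h c i = (of_bool (c (Suc i)) :: nat)" for c i
  have h1: "\<forall>i. h c i \<le> 1" for c by (simp add: h_def)
  define g where "g c = val 2 (h c) 0" for c
  \<comment> \<open>Tails vary by at most \<open>2 * \<rho> - C0 \<le> 2 * \<rho> - 1\<close> and
    distinct digits differ by at least 1, which leaves \<open>1 - (2 * \<rho> - 1)\<close>.\<close>
  define \<kappa> where "\<kappa> = 2 * (1 - \<rho>)"
  have kap: "\<kappa> > 0" using rho by (simp add: \<kappa>_def)
  \<comment> \<open>Chosen so that \<open>\<beta>\<close> to the power \<open>M * s0\<close> is 2:
    one letter of \<open>c\<close> accounts for \<open>M\<close> digits in base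
    \<open>\<beta>\<close> and for one binary digit of \<open>g c\<close>.\<close>
  define s0 where "s0 = ln 2 / (real M * ln \<beta>)"
  have s0: "s0 > 0" using b1 M by (simp add: s0_def)
  \<comment> \<open>The factor 2 absorbs the shift by one between the letters of \<open>c\<close>
    and the binary digits of \<open>g c\<close>.\<close>
  define C where "C = 2 / \<kappa> powr s0"
  have C: "C > 0" using kap by (simp add: C_def)
  have H: "\<bar>g c - g c'\<bar> \<le> C * \<bar>val \<beta> (e c) 0 - val \<beta> (e c') 0\<bar> powr s0" if c: "c \<in> S" "c' \<in> S" for c c'
  proof (cases "c = c'")
    case True
    then show ?thesis using C by simp
  next
    case False
    then obtain j where j: "\<forall>i<j. c i = c' i" "c j \<noteq> c' j" by (rule first_difference)
    have j0: "0 < j" using c j by (cases j) (auto simp: S_def)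
    define L where "L = M * j - 1"
    have SL: "Suc L = M * j" using M j0 by (simp add: L_def)
    have same: "dbl n c i = dbl n c' i" if i: "i < M * j" for i
    proof -
      have "i div M < j" using i M by (simp add: less_mult_imp_div_less mult.commute)
      then show ?thesis using j(1) by (simp add: dbl_def M_def)
    qed
    have diff: "dbl n c (Suc L) \<noteq> dbl n c' (Suc L)"
      unfolding SL using j(2) by (auto simp: dbl_def M_def)
    have agr: "\<forall>i<L. e c (0 + i) = e c' (0 + i)"
      using same SL by (simp add: e_def code_def)
    have "dbl n c L = dbl n c' L" using same[of L] SL by simp
    then have "e c L \<noteq> e c' L" using diff m by (auto simp: e_def code_def of_bool_def)
    then have d1: "1 \<le> \<bar>real (e c L) - real (e c' L)\<bar>" by linarith
    let ?x = "val \<beta> (e c)" and ?y = "val \<beta> (e c')"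
    have o: "orb \<beta> (e d) (val \<beta> (e d))" for d using u by (simp add: uorb_def)
    have "?x 0 - ?y 0 = (real (e c (0 + L)) - real (e c' (0 + L)) + ?x (Suc (0 + L)) - ?y (Suc (0 + L))) / \<beta> ^ Suc L"
      by (rule orb_differ[OF b1 o o agr])
    then have ex: "\<bar>?x 0 - ?y 0\<bar> = \<bar>real (e c L) - real (e c' L) + ?x (Suc L) - ?y (Suc L)\<bar> / \<beta> ^ Suc L"
      using b1 by (simp add: abs_divide del: power_Suc)
    have "\<kappa> \<le> \<bar>real (e c L) - real (e c' L) + ?x (Suc L) - ?y (Suc L)\<bar>"
    proof -
      have "\<bar>?x (Suc L) - ?y (Suc L)\<bar> \<le> 2 * \<rho> - 1"
        using val_e(1)[of c "Suc L"] val_e(1)[of c' "Suc L"] low[of c "Suc L"] low[of c' "Suc L"] C0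
        unfolding abs_le_iff by (intro conjI) linarith+
      moreover have "1 - r \<le> \<bar>d + D\<bar>" if "1 \<le> \<bar>d\<bar>" "\<bar>D\<bar> \<le> r" for d D r :: real using that by linarith
      ultimately have "1 - (2 * \<rho> - 1) \<le> \<bar>(real (e c L) - real (e c' L)) + (?x (Suc L) - ?y (Suc L))\<bar>"
        using d1 by blast
      then show ?thesis by (simp add: \<kappa>_def add_diff_eq)
    qed
    then have far: "\<kappa> / \<beta> ^ (M * j) \<le> \<bar>?x 0 - ?y 0\<bar>"
      unfolding ex SL using b1 by (intro divide_right_mono) auto
    have "(\<kappa> / \<beta> ^ (M * j)) powr s0 = \<kappa> powr s0 / 2 ^ j"
    proof -
      have "(\<beta> ^ (M * j)) powr s0 = exp (s0 * (real (M * j) * ln \<beta>))" using b1 by (simp add: powr_def ln_realpow)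
      also have "s0 * (real (M * j) * ln \<beta>) = real j * ln 2" using b1 M by (simp add: s0_def field_simps)
      also have "exp (real j * ln 2) = (2::real) ^ j" by (simp add: exp_of_nat_mult)
      finally show ?thesis using kap b1 by (simp add: powr_divide)
    qed
    moreover have "(\<kappa> / \<beta> ^ (M * j)) powr s0 \<le> \<bar>?x 0 - ?y 0\<bar> powr s0"
      using far kap b1 s0 by (intro powr_mono2) auto
    ultimately have P: "\<kappa> powr s0 / 2 ^ j \<le> \<bar>?x 0 - ?y 0\<bar> powr s0" by simp
    have "g c - g c' = (val 2 (h c) (0 + (j - 1)) - val 2 (h c') (0 + (j - 1))) / 2 ^ (j - 1)"
      unfolding g_def using j(1)
      by (intro orb_agree[OF _ val_orb[OF _ h1] val_orb[OF _ h1]]) (auto simp: h_def)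
    then have "\<bar>g c - g c'\<bar> = \<bar>val 2 (h c) (j - 1) - val 2 (h c') (j - 1)\<bar> / 2 ^ (j - 1)" by (simp add: abs_divide)
    also have "\<dots> \<le> 1 / 2 ^ (j - 1)"
      using val_bounds[OF _ h1, of 2 c "j - 1"] val_bounds[OF _ h1, of 2 c' "j - 1"] by (intro divide_right_mono) auto
    also have "\<dots> = 2 / 2 ^ j" using j0 by (cases j) auto
    also have "\<dots> = C * (\<kappa> powr s0 / 2 ^ j)" using kap by (simp add: C_def)
    also have "\<dots> \<le> C * \<bar>?x 0 - ?y 0\<bar> powr s0" using P C by (intro mult_left_mono) auto
    finally show ?thesis .
  qed
  have "s0 \<le> hausdorff_dim (W_bm \<beta> m)"
  proof (rule hausdorff_dim_ge[where f = "\<lambda>c. val \<beta> (e c) 0" and g = g and S = S, OF W_subset_unit[OF b1 b(2)] _ _ C s0 H])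
    show "val \<beta> (e c) 0 \<in> W_bm \<beta> m" for c using W_iff[OF b1 b(2)] u by blast
    show "{0..1} \<subseteq> g ` S"
    proof
      fix x :: real assume x: "x \<in> {0..1}"
      obtain \<delta> where d: "\<forall>i. \<delta> i \<le> (1::nat)" "(\<lambda>i. real (\<delta> i) / 2 ^ Suc i) sums x"
        using ex_expansion[of 2 1 x] x by auto
      define c where "c i = (i > 0 \<and> \<delta> (i - 1) = 1)" for i
      have "h c = \<delta>"
      proof
        fix i show "h c i = \<delta> i" using d(1)[rule_format, of i] by (auto simp: h_def c_def of_bool_def)
      qed
      then have "x = g c" using d(2) by (simp add: g_def val_def sums_iff)
      moreover have "c \<in> S" by (simp add: S_def c_def)
      ultimately show "x \<in> g ` S" by blast
    qed
  qed auto
  then show ?thesis using s0 by linarith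
qed

section \<open>The four ranges of the base\<close>

theorem theorem4p5:
  fixes m :: nat
  assumes "m \<ge> 2"
  shows "(\<forall>\<beta>. G_m m < \<beta> \<and> \<beta> \<le> beta_f m \<longrightarrow>
            card (W_bm \<beta> m) = (if even m then 1 else 2))
       \<and> (\<forall>\<beta>. beta_f m < \<beta> \<and> \<beta> < beta_c m \<longrightarrow> W_bm \<beta> m \<approx> (UNIV :: nat set))
       \<and> W_bm (beta_c m) m \<approx> (UNIV :: real set)
       \<and> (\<forall>\<beta>. beta_c m < \<beta> \<and> \<beta> \<le> real m + 1 \<longrightarrow> hausdorff_dim (W_bm \<beta> m) > 0)"
proof (intro conjI allI impI)
  define k where "k = m div 2"
  have k: "k \<ge> 1" using assms by (simp add: k_def)
  have mk: "m = (if even m then 2 * k else 2 * k + 1)" by (simp add: k_def)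
  show "card (W_bm \<beta> m) = (if even m then 1 else 2)" if h: "G_m m < \<beta> \<and> \<beta> \<le> beta_f m" for \<beta>
  proof (cases "even m")
    case True
    then have mk: "m = 2 * k" using mk by simp
    have g: "real k + 1 < \<beta>" using h mk by (simp add: G_m_def Let_def)
    then have "\<beta>\<^sup>2 - (real k + 1) * \<beta> - real k \<le> 0" using beta_f_even[of \<beta> k] h mk k by simp
    from W_even_singleton[OF k g this] show ?thesis using mk by simp
  next
    case False
    then have mk: "m = 2 * k + 1" using mk by simp
    have "G_m (2 * k + 1) < \<beta>" using h mk by simp
    note g = G_m_odd[OF this]
    have "\<beta> ^ 3 - (real k + 2) * \<beta>\<^sup>2 + \<beta> - (real k + 1) \<le> 0" using beta_f_odd(2)[OF k g(1)] h mk by simp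
    note W = W_odd_pair[OF k g this]
    have "card {A + t, A - t} = 2" if "0 < t" for A t :: real using that by (simp add: card_insert_if)
    moreover have "0 < 1 / (2 * (\<beta> + 1))" using g(1) by simp
    ultimately have "card (W_bm \<beta> (2 * k + 1)) = 2" unfolding W by blast
    then show ?thesis using mk False by simp
  qed
  show "W_bm \<beta> m \<approx> (UNIV :: nat set)" if h: "beta_f m < \<beta> \<and> \<beta> < beta_c m" for \<beta>
  proof -
    have bm: "\<beta> \<le> real m + 1" using h beta_c(3)[OF assms] by simp
    have b1: "1 < \<beta>" and inf: "infinite (W_bm \<beta> m)"
    proof -
      show b1: "1 < \<beta>"
      proof (cases "even m")
        case True
        have "1 \<le> beta_f (2 * k)" using beta_f_even[of 1 k] k by simp
        then show ?thesis using h mk True by simp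
      next
        case False
        then show ?thesis using h mk beta_f_odd(1)[OF k] by simp
      qed
      show "infinite (W_bm \<beta> m)"
      proof (cases "even m")
        case True
        then have mk: "m = 2 * k" using mk by simp
        then show ?thesis using W_even_infinite[OF k b1] bm beta_f_even[of \<beta> k] b1 k h by simp
      next
        case False
        then have mk: "m = 2 * k + 1" using mk by simp
        have "real k + 1 < \<beta>" using beta_f_odd(1)[OF k] h mk by simp
        then show ?thesis using W_odd_infinite[OF b1, of k] bm beta_f_odd(2)[OF k, of \<beta>] h mk by simp
      qed
    qed
    have "countable (W_bm \<beta> m)" using countable_W[OF assms b1] h by blast
    then have "W_bm \<beta> m \<lesssim> (UNIV :: nat set)" by (auto simp: countable_def lepoll_def)
    moreover have "(UNIV :: nat set) \<lesssim> W_bm \<beta> m" using inf infinite_le_lepoll by blast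
    ultimately show ?thesis by (rule lepoll_antisym)
  qed
  show "W_bm (beta_c m) m \<approx> (UNIV :: real set)"
    using subset_imp_lepoll[OF subset_UNIV] lepoll_trans[OF real_lepoll_nat_sets W_beta_c_lepoll[OF assms]]
    by (rule lepoll_antisym)
  show "hausdorff_dim (W_bm \<beta> m) > 0" if "beta_c m < \<beta> \<and> \<beta> \<le> real m + 1" for \<beta>
    using hausdorff_dim_W_pos[OF assms] that by blast
qed

end
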